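(* Let $G$ be an operator system with unit $1$ and let $\Omega$ be an open fully matricial $G$-set. Then the maps ${}_{2,1}\partial_1$ and ${}_{2,2}\partial_1$ from $\mathcal{F}^{(2)}(\Omega;\Omega:\mathbb{C})$ to $\mathcal{F}^{(3)}(\Omega;\Omega;\Omega:\mathbb{C})$ are extensions of Voiculescu's second order derivations $\partial\otimes\mathrm{id}$ and $\mathrm{id}\otimes\partial$ from $A(\Omega;\Omega)$ to $A(\Omega;\Omega;\Omega)$, respectively; that is, ${}_{2,1}\partial_1f=(\partial\otimes\mathrm{id})f$ and ${}_{2,2}\partial_1f=(\mathrm{id}\otimes\partial)f$ for all $f\in A(\Omega;\Omega)$.
   Context: An operator system $G$ is a $*$-closed subspace, containing the unit $1$, of a unital C*-algebra; $M_n(G)=M_n(\mathbb{C})\otimes G$ carries the norm inherited from the C*-algebra of $n\times n$ matrices. An open fully matricial $G$-set is $\Omega=(\Omega_n)_{n\ge1}$ with $\Omega_n\subset M_n(G)$ open, $\Omega_m\oplus\Omega_n=\Omega_{m+n}\cap(M_m(G)\oplus M_n(G))$, and $(s\otimes1)\Omega_n(s\otimes1)^{-1}=\Omega_n$ for $s\in GL_n(\mathbb{C})$. It is right admissible: for $X\in\Omega_n$, $Y\in\Omega_m$, $Z\in M_{n,m}(G)$ there is $r\in\mathbb{C}\setminus\{0\}$ with $\left[\begin{smallmatrix}X&rZ\\0&Y\end{smallmatrix}\right]\in\Omega_{n+m}$. For $k=2,3$, $\mathcal{F}^{(k)}(\Omega;\dots;\Omega:\mathbb{C})$ is the space of families of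 maps $f_{n_1;\dots;n_k}:\Omega_{n_1}\times\cdots\times\Omega_{n_k}\to M_{n_1}(\mathbb{C})\otimes\cdots\otimes M_{n_k}(\mathbb{C})$ which, in each variable separately (the others fixed), send direct sums to direct sums and conjugation by $s\otimes1$, $s\in GL(\mathbb{C})$, to conjugation by $s$, on the corresponding tensor leg. $A(\Omega;\Omega)$ and $A(\Omega;\Omega;\Omega)$ are the subspaces of families of analytic maps. For $f\in\mathcal{F}^{(2)}(\Omega;\Omega:\mathbb{C})$ put $F(X;Y)(Z)=f_{n;m}(X;Y)\#Z$ for $X\in\Omega_n$, $Y\in\Omega_m$, $Z\in M_{n,m}(\mathbb{C})$, where $(A\otimes C)\#Z=AZC$. The directional nc difference-differential operators ${}_{1,0}\Delta_1F$ and ${}_{1,1}\Delta_1F$ are the bilinear-map-valued functions determined by the following (independently of the choices made): (i) for $X'\in\Omega_{n'}$, $X''\in\Omega_{n''}$, $Y\in\Omega_m$, $\gamma\in M_{n',n''}(\mathbb{C})$, $Z'\in M_{n',m}(\mathbb{C})$, $Z''\in M_{n'',m}(\mathbb{C})$ and $r\ne0$ with $\left[\begin{smallmatrix}X'&r\gamma\otimes1\\0&X''\end{smallmatrix}\right]\in\Omega_{n'+n''}$, $$F\big(\left[\begin{smallmatrix}X'&r\gamma\otimes1\\0&X''\end{smallmatrix}\right];Y\big)\big(\left[\begin{smallmatrix}Z'\\ Z''\end{smallmatrix}\right]\big)=\begin{bmatrix}F(X';Y)(Z')+r({}_{1,0}\Delta_1F)(X';X'';Y)(\gamma;Z'')\\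 F(X'';Y)(Z'')\end{bmatrix};$$ (ii) for $X\in\Omega_n$, $Y'\in\Omega_{m'}$, $Y''\in\Omega_{m''}$, $\gamma\in M_{m',m''}(\mathbb{C})$, $Z'\in M_{n,m'}(\mathbb{C})$, $Z''\in M_{n,m''}(\mathbb{C})$ and $r\neq0$ with $\left[\begin{smallmatrix}Y'&r\gamma\otimes1\\0&Y''\end{smallmatrix}\right]\in\Omega_{m'+m''}$, $$F\big(X;\left[\begin{smallmatrix}Y'&r\gamma\otimes1\\0&Y''\end{smallmatrix}\right]\big)\big([Z'\ Z'']\big)=\big[F(X;Y')(Z')\quad r({}_{1,1}\Delta_1F)(X;Y';Y'')(Z';\gamma)+F(X;Y'')(Z'')\big].$$ Then ${}_{2,1}\partial_1f$ (resp. ${}_{2,2}\partial_1f$) is the element of $\mathcal{F}^{(3)}(\Omega;\Omega;\Omega:\mathbb{C})$ corresponding to ${}_{1,0}\Delta_1F$ (resp. ${}_{1,1}\Delta_1F$) under the isomorphism identifying $A\otimes B\otimes C\in M_{n_1}(\mathbb{C})\otimes M_{n_2}(\mathbb{C})\otimes M_{n_3}(\mathbb{C})$ with the bilinear map $(Z_1;Z_2)\mapsto AZ_1BZ_2C$ on $M_{n_1,n_2}(\mathbb{C})\times M_{n_2,n_3}(\mathbb{C})$. Voiculescu's operators, for $f\in A(\Omega;\Omega)$ (with matrix units $e$ and $(T)_{(i,j)(p,q)}$ the coefficient of $e_{i,j}\otimes e_{p,q}$ in $T$; sums over $1\le a,b\le n$, $1\le c,d\le n'$, $1\le e,f\le l$):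 $$((\partial\otimes\mathrm{id})f)_{n;n';l}(X;X';Y)=\sum\Big(\tfrac{d}{d\epsilon}f_{n+n';l}\big(\left[\begin{smallmatrix}X&\epsilon e^{(n,n')}_{b,c}\otimes1\\0&X'\end{smallmatrix}\right];Y\big)\big|_{\epsilon=0}\Big)_{(a,n+d)(e,f)}e^{(n)}_{a,b}\otimes e^{(n')}_{c,d}\otimes e^{(l)}_{e,f},$$ $$((\mathrm{id}\otimes\partial)f)_{l;n;n'}(Y;X;X')=\sum\Big(\tfrac{d}{d\epsilon}f_{l;n+n'}\big(Y;\left[\begin{smallmatrix}X&\epsilon e^{(n,n')}_{b,c}\otimes1\\0&X'\end{smallmatrix}\right]\big)\big|_{\epsilon=0}\Big)_{(e,f)(a,n+d)}e^{(l)}_{e,f}\otimes e^{(n)}_{a,b}\otimes e^{(n')}_{c,d}.$$ *)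

theory Defs
  imports "HOL-Analysis.Derivative" "Jordan_Normal_Form.Matrix"
begin

hide_const (open) Finite_Cartesian_Product.mat

section \<open>Unital C*-algebras and operator systems\<close>

class unital_cstar_algebra = real_normed_algebra_1 + banach +
  fixes scaleC :: "complex \<Rightarrow> 'a \<Rightarrow> 'a" (infixr "*\<^sub>C" 75)
    and star :: "'a \<Rightarrow> 'a"
  assumes scaleC_add_right: "c *\<^sub>C (x + y) = c *\<^sub>C x + c *\<^sub>C y"
    and scaleC_add_left: "(c + d) *\<^sub>C x = c *\<^sub>C x + d *\<^sub>C x"
    and scaleC_scaleC: "c *\<^sub>C d *\<^sub>C x = (c * d) *\<^sub>C x"
    and scaleC_of_real: "complex_of_real r *\<^sub>C x = r *\<^sub>R x"
    and mult_scaleC_left: "(c *\<^sub>C x) * y = c *\<^sub>C (x * y)"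
    and mult_scaleC_right: "x * (c *\<^sub>C y) = c *\<^sub>C (x * y)"
    and norm_scaleC: "norm (c *\<^sub>C x) = cmod c * norm x"
    and star_star: "star (star x) = x"
    and star_add: "star (x + y) = star x + star y"
    and star_scaleC: "star (c *\<^sub>C x) = cnj c *\<^sub>C star x"
    and star_mult: "star (x * y) = star y * star x"
    and cstar_identity: "norm (star x * x) = (norm x)\<^sup>2"

definition operator_system :: "'a::unital_cstar_algebra set \<Rightarrow> bool" where
  "operator_system G \<longleftrightarrow>
     1 \<in> G \<and> (\<forall>x\<in>G. \<forall>y\<in>G. x + y \<in> G) \<and> (\<forall>c. \<forall>x\<in>G. c *\<^sub>C x \<in> G) \<and> (\<forall>x\<in>G. star x \<in> G)"

section \<open>Matrices over a C*-algebra\<close>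

definition mats :: "nat \<Rightarrow> nat \<Rightarrow> 'a set \<Rightarrow> 'a mat set" where
  "mats n m G = {X \<in> carrier_mat n m. elements_mat X \<subseteq> G}"

definition cscale_mat :: "complex \<Rightarrow> 'a::unital_cstar_algebra mat \<Rightarrow> 'a mat" where
  "cscale_mat c X = map_mat ((*\<^sub>C) c) X"

definition star_mat :: "'a::unital_cstar_algebra mat \<Rightarrow> 'a mat" where
  "star_mat X = map_mat star (transpose_mat X)"

text \<open>The scalar matrix \<open>s \<otimes> 1\<close>.\<close>

definition scalar_mat :: "complex mat \<Rightarrow> 'a::unital_cstar_algebra mat" where
  "scalar_mat s = map_mat (\<lambda>z. z *\<^sub>C 1) s"

text \<open>\<open>N\<close> is a complete C*-norm on the *-algebra of all \<open>n \<times> n\<close> matrices. There is exactly one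
  such norm, because a *-algebra carries at most one complete C*-norm; so quantifying over \<open>N\<close>
  below amounts to fixing the norm of the C*-algebra of matrices.\<close>

definition cstar_norm_mat :: "nat \<Rightarrow> ('a::unital_cstar_algebra mat \<Rightarrow> real) \<Rightarrow> bool" where
  "cstar_norm_mat n N \<longleftrightarrow>
     (\<forall>X\<in>carrier_mat n n. 0 \<le> N X \<and> (N X = 0 \<longleftrightarrow> X = 0\<^sub>m n n)) \<and>
     (\<forall>X\<in>carrier_mat n n. \<forall>Y\<in>carrier_mat n n. N (X + Y) \<le> N X + N Y \<and> N (X * Y) \<le> N X * N Y) \<and>
     (\<forall>c. \<forall>X\<in>carrier_mat n n. N (cscale_mat c X) = cmod c * N X) \<and>
     (\<forall>X\<in>carrier_mat n n. N (star_mat X * X) = (N X)\<^sup>2) \<and>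
     (\<forall>S. (\<forall>k. S k \<in> carrier_mat n n) \<longrightarrow>
          (\<forall>e>0. \<exists>k0::nat. \<forall>k\<ge>k0. \<forall>l\<ge>k0. N (S k - S l) < e) \<longrightarrow>
          (\<exists>L\<in>carrier_mat n n. (\<lambda>k. N (S k - L)) \<longlonglongrightarrow> 0))"

definition matrix_cstar_norms :: "(nat \<Rightarrow> 'a::unital_cstar_algebra mat \<Rightarrow> real) \<Rightarrow> bool" where
  "matrix_cstar_norms N \<longleftrightarrow> (\<forall>n\<ge>1. cstar_norm_mat n (N n))"

definition upper_block :: "'a::zero mat \<Rightarrow> 'a mat \<Rightarrow> 'a mat \<Rightarrow> 'a mat" where
  "upper_block X Z Y = four_block_mat X Z (0\<^sub>m (dim_row Y) (dim_col X)) Y"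

definition dsum :: "'a::zero mat \<Rightarrow> 'a mat \<Rightarrow> 'a mat" where
  "dsum X Y = upper_block X (0\<^sub>m (dim_row X) (dim_col Y)) Y"

definition append_cols_mat :: "'a::zero mat \<Rightarrow> 'a mat \<Rightarrow> 'a mat" (infixr "@\<^sub>h" 65) where
  "A @\<^sub>h B = four_block_mat A B (0\<^sub>m 0 (dim_col A)) (0\<^sub>m 0 (dim_col B))"

text \<open>\<open>GL\<^sub>n(\<complex>)\<close>, each element being paired with its inverse.\<close>

definition GL :: "nat \<Rightarrow> (complex mat \<times> complex mat) set" where
  "GL n = {(s, t). s \<in> carrier_mat n n \<and> t \<in> carrier_mat n n \<and> s * t = 1\<^sub>m n \<and> t * s = 1\<^sub>m n}"

section \<open>Open fully matricial sets\<close>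

text \<open>A family indexed by \<open>n \<ge> 1\<close> is encoded by a family on all of \<open>nat\<close> that is empty at \<open>0\<close>.\<close>

definition open_fully_matricial ::
  "(nat \<Rightarrow> 'a::unital_cstar_algebra mat \<Rightarrow> real) \<Rightarrow> 'a set \<Rightarrow> (nat \<Rightarrow> 'a mat set) \<Rightarrow> bool" where
  "open_fully_matricial N G \<Omega> \<longleftrightarrow>
     \<Omega> 0 = {} \<and>
     (\<forall>n\<ge>1. \<Omega> n \<subseteq> mats n n G \<and>
        (\<forall>X\<in>\<Omega> n. \<exists>d>0. \<forall>Y\<in>mats n n G. N n (Y - X) < d \<longrightarrow> Y \<in> \<Omega> n)) \<and>
     (\<forall>m\<ge>1. \<forall>n\<ge>1. {dsum X Y | X Y. X \<in> \<Omega> m \<and> Y \<in> \<Omega> n} =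
        \<Omega> (m + n) \<inter> {dsum X Y | X Y. X \<in> mats m m G \<and> Y \<in> mats n n G}) \<and>
     (\<forall>n\<ge>1. \<forall>(s, t)\<in>GL n. (\<lambda>X. scalar_mat s * X * scalar_mat t) ` \<Omega> n = \<Omega> n)"

section \<open>Tensor products of scalar matrix algebras\<close>

text \<open>An element of a tensor product of matrix algebras is encoded by its coefficients with respect
  to the products of matrix units (indices start at \<open>0\<close>); coefficients out of range vanish.\<close>

type_synonym tensor2 = "nat \<times> nat \<Rightarrow> nat \<times> nat \<Rightarrow> complex"
type_synonym tensor3 = "nat \<times> nat \<Rightarrow> nat \<times> nat \<Rightarrow> nat \<times> nat \<Rightarrow> complex"

definition idx :: "nat \<Rightarrow> (nat \<times> nat) set" where
  "idx n = {..<n} \<times> {..<n}"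

definition tens2 :: "nat \<Rightarrow> nat \<Rightarrow> tensor2 set" where
  "tens2 n1 n2 = {T. \<forall>u v. T u v \<noteq> 0 \<longrightarrow> u \<in> idx n1 \<and> v \<in> idx n2}"

definition tens3 :: "nat \<Rightarrow> nat \<Rightarrow> nat \<Rightarrow> tensor3 set" where
  "tens3 n1 n2 n3 = {T. \<forall>u v w. T u v w \<noteq> 0 \<longrightarrow> u \<in> idx n1 \<and> v \<in> idx n2 \<and> w \<in> idx n3}"

text \<open>The operation determined by \<open>(A \<otimes> C) # Z = A Z C\<close>.\<close>

definition sharp2 :: "nat \<Rightarrow> nat \<Rightarrow> tensor2 \<Rightarrow> complex mat \<Rightarrow> complex mat" where
  "sharp2 n m T Z = mat n m (\<lambda>(i, q). \<Sum>j<n. \<Sum>p<m. T (i, j) (p, q) * Z $$ (j, p))"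

text \<open>The operation determined by \<open>(A \<otimes> B \<otimes> C) # (Z1; Z2) = A Z1 B Z2 C\<close>, and the tensor
  corresponding to a bilinear map under the resulting isomorphism.\<close>

definition sharp3 ::
  "nat \<Rightarrow> nat \<Rightarrow> nat \<Rightarrow> tensor3 \<Rightarrow> complex mat \<Rightarrow> complex mat \<Rightarrow> complex mat" where
  "sharp3 n1 n2 n3 T Z1 Z2 = mat n1 n3 (\<lambda>(i, q).
     \<Sum>j<n1. \<Sum>k<n2. \<Sum>l<n2. \<Sum>p<n3. T (i, j) (k, l) (p, q) * Z1 $$ (j, k) * Z2 $$ (l, p))"

definition tensor_of_bilinear ::
  "nat \<Rightarrow> nat \<Rightarrow> nat \<Rightarrow> (complex mat \<Rightarrow> complex mat \<Rightarrow> complex mat) \<Rightarrow> tensor3" where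
  "tensor_of_bilinear n1 n2 n3 B = (THE T. T \<in> tens3 n1 n2 n3 \<and>
     (\<forall>Z1\<in>carrier_mat n1 n2. \<forall>Z2\<in>carrier_mat n2 n3. sharp3 n1 n2 n3 T Z1 Z2 = B Z1 Z2))"

section \<open>Noncommutative functions of several variables\<close>

text \<open>The conditions on a family in one of its variables. For the tensor-valued families below they
  are imposed, on the leg of that variable, separately for each choice of matrix unit in every
  other leg; this says that they hold for the tensor.\<close>

definition nc_fun ::
  "(nat \<Rightarrow> 'a::unital_cstar_algebra mat set) \<Rightarrow> (nat \<Rightarrow> 'a mat \<Rightarrow> complex mat) \<Rightarrow> bool" where
  "nc_fun \<Omega> \<phi> \<longleftrightarrow>
     (\<forall>m n. \<forall>X\<in>\<Omega> m. \<forall>Y\<in>\<Omega> n. \<phi> (m + n) (dsum X Y) = dsum (\<phi> m X) (\<phi> n Y)) \<and>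
     (\<forall>n. \<forall>X\<in>\<Omega> n. \<forall>(s, t)\<in>GL n. \<phi> n (scalar_mat s * X * scalar_mat t) = s * \<phi> n X * t)"

type_synonym 'a family2 = "nat \<Rightarrow> nat \<Rightarrow> 'a mat \<Rightarrow> 'a mat \<Rightarrow> tensor2"
type_synonym 'a family3 = "nat \<Rightarrow> nat \<Rightarrow> nat \<Rightarrow> 'a mat \<Rightarrow> 'a mat \<Rightarrow> 'a mat \<Rightarrow> tensor3"

text \<open>Members of the following spaces are functions on \<open>\<Omega>\<close>: their values at other arguments are
  irrelevant.\<close>

definition nc2 :: "(nat \<Rightarrow> 'a::unital_cstar_algebra mat set) \<Rightarrow> 'a family2 set" where
  "nc2 \<Omega> = {f.
     (\<forall>n m. \<forall>X\<in>\<Omega> n. \<forall>Y\<in>\<Omega> m. f n m X Y \<in> tens2 n m) \<and>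
     (\<forall>m. \<forall>Y\<in>\<Omega> m. \<forall>v\<in>idx m. nc_fun \<Omega> (\<lambda>n X. mat n n (\<lambda>u. f n m X Y u v))) \<and>
     (\<forall>n. \<forall>X\<in>\<Omega> n. \<forall>u\<in>idx n. nc_fun \<Omega> (\<lambda>m Y. mat m m (\<lambda>v. f n m X Y u v)))}"

definition nc3 :: "(nat \<Rightarrow> 'a::unital_cstar_algebra mat set) \<Rightarrow> 'a family3 set" where
  "nc3 \<Omega> = {g.
     (\<forall>n1 n2 n3. \<forall>X1\<in>\<Omega> n1. \<forall>X2\<in>\<Omega> n2. \<forall>X3\<in>\<Omega> n3. g n1 n2 n3 X1 X2 X3 \<in> tens3 n1 n2 n3) \<and>
     (\<forall>n2 n3. \<forall>X2\<in>\<Omega> n2. \<forall>X3\<in>\<Omega> n3. \<forall>v\<in>idx n2. \<forall>w\<in>idx n3.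
        nc_fun \<Omega> (\<lambda>n1 X1. mat n1 n1 (\<lambda>u. g n1 n2 n3 X1 X2 X3 u v w))) \<and>
     (\<forall>n1 n3. \<forall>X1\<in>\<Omega> n1. \<forall>X3\<in>\<Omega> n3. \<forall>u\<in>idx n1. \<forall>w\<in>idx n3.
        nc_fun \<Omega> (\<lambda>n2 X2. mat n2 n2 (\<lambda>v. g n1 n2 n3 X1 X2 X3 u v w))) \<and>
     (\<forall>n1 n2. \<forall>X1\<in>\<Omega> n1. \<forall>X2\<in>\<Omega> n2. \<forall>u\<in>idx n1. \<forall>v\<in>idx n2.
        nc_fun \<Omega> (\<lambda>n3 X3. mat n3 n3 (\<lambda>w. g n1 n2 n3 X1 X2 X3 u v w)))}"

text \<open>Analyticity means: locally bounded and Gateaux differentiable, jointly in both variables.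
  The values lie in a finite-dimensional space, so both conditions may be read off from the
  coefficients; \<open>G\<close> itself need not be complete.\<close>

definition analytic2 ::
  "(nat \<Rightarrow> 'a::unital_cstar_algebra mat \<Rightarrow> real) \<Rightarrow> 'a set \<Rightarrow> (nat \<Rightarrow> 'a mat set) \<Rightarrow> 'a family2 set"
  where
  "analytic2 N G \<Omega> = {f \<in> nc2 \<Omega>. \<forall>n m. \<forall>X\<in>\<Omega> n. \<forall>Y\<in>\<Omega> m.
     (\<exists>d>0. \<exists>C. \<forall>X'\<in>\<Omega> n. \<forall>Y'\<in>\<Omega> m. N n (X' - X) < d \<and> N m (Y' - Y) < d \<longrightarrow>
        (\<forall>u v. cmod (f n m X' Y' u v) \<le> C)) \<and>
     (\<forall>H\<in>mats n n G. \<forall>K\<in>mats m m G. \<forall>u v.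
        (\<lambda>z. f n m (X + cscale_mat z H) (Y + cscale_mat z K) u v) field_differentiable (at 0))}"

section \<open>Directional difference-differential operators\<close>

definition lin_of :: "'a family2 \<Rightarrow> nat \<Rightarrow> nat \<Rightarrow> 'a mat \<Rightarrow> 'a mat \<Rightarrow> complex mat \<Rightarrow> complex mat" where
  "lin_of f n m X Y Z = sharp2 n m (f n m X Y) Z"

text \<open>The defining identities are required for all admissible choices of \<open>r\<close> and of the remaining
  block \<open>Z'\<close> (respectively \<open>Z''\<close>).\<close>

definition Delta10 ::
  "(nat \<Rightarrow> 'a::unital_cstar_algebra mat set) \<Rightarrow>
   (nat \<Rightarrow> nat \<Rightarrow> 'a mat \<Rightarrow> 'a mat \<Rightarrow> complex mat \<Rightarrow> complex mat) \<Rightarrow>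
   nat \<Rightarrow> nat \<Rightarrow> nat \<Rightarrow> 'a mat \<Rightarrow> 'a mat \<Rightarrow> 'a mat \<Rightarrow> complex mat \<Rightarrow> complex mat \<Rightarrow> complex mat"
  where
  "Delta10 \<Omega> F n' n'' m X' X'' Y \<gamma> Z'' = (THE W. W \<in> carrier_mat n' m \<and>
     (\<forall>r. \<forall>Z'\<in>carrier_mat n' m.
        r \<noteq> 0 \<and> upper_block X' (scalar_mat (r \<cdot>\<^sub>m \<gamma>)) X'' \<in> \<Omega> (n' + n'') \<longrightarrow>
        F (n' + n'') m (upper_block X' (scalar_mat (r \<cdot>\<^sub>m \<gamma>)) X'') Y (Z' @\<^sub>r Z'') =
          (F n' m X' Y Z' + r \<cdot>\<^sub>m W) @\<^sub>r F n'' m X'' Y Z''))"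

definition Delta11 ::
  "(nat \<Rightarrow> 'a::unital_cstar_algebra mat set) \<Rightarrow>
   (nat \<Rightarrow> nat \<Rightarrow> 'a mat \<Rightarrow> 'a mat \<Rightarrow> complex mat \<Rightarrow> complex mat) \<Rightarrow>
   nat \<Rightarrow> nat \<Rightarrow> nat \<Rightarrow> 'a mat \<Rightarrow> 'a mat \<Rightarrow> 'a mat \<Rightarrow> complex mat \<Rightarrow> complex mat \<Rightarrow> complex mat"
  where
  "Delta11 \<Omega> F n m' m'' X Y' Y'' Z' \<gamma> = (THE W. W \<in> carrier_mat n m'' \<and>
     (\<forall>r. \<forall>Z''\<in>carrier_mat n m''.
        r \<noteq> 0 \<and> upper_block Y' (scalar_mat (r \<cdot>\<^sub>m \<gamma>)) Y'' \<in> \<Omega> (m' + m'') \<longrightarrow>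
        F n (m' + m'') X (upper_block Y' (scalar_mat (r \<cdot>\<^sub>m \<gamma>)) Y'') (Z' @\<^sub>h Z'') =
          F n m' X Y' Z' @\<^sub>h (r \<cdot>\<^sub>m W + F n m'' X Y'' Z'')))"

definition partial21 ::
  "(nat \<Rightarrow> 'a::unital_cstar_algebra mat set) \<Rightarrow> 'a family2 \<Rightarrow> 'a family3" where
  "partial21 \<Omega> f n1 n2 n3 X1 X2 X3 =
     tensor_of_bilinear n1 n2 n3 (Delta10 \<Omega> (lin_of f) n1 n2 n3 X1 X2 X3)"

definition partial22 ::
  "(nat \<Rightarrow> 'a::unital_cstar_algebra mat set) \<Rightarrow> 'a family2 \<Rightarrow> 'a family3" where
  "partial22 \<Omega> f n1 n2 n3 X1 X2 X3 =
     tensor_of_bilinear n1 n2 n3 (Delta11 \<Omega> (lin_of f) n1 n2 n3 X1 X2 X3)"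

section \<open>Voiculescu's derivations\<close>

definition matrix_unit :: "nat \<Rightarrow> nat \<Rightarrow> nat \<Rightarrow> nat \<Rightarrow> complex mat" where
  "matrix_unit n m i j = mat n m (\<lambda>u. if u = (i, j) then 1 else 0)"

definition partial_id :: "'a::unital_cstar_algebra family2 \<Rightarrow> 'a family3" where
  "partial_id f n n' l X X' Y = (\<lambda>(a, b) (c, d) (e, g).
     if (a, b) \<in> idx n \<and> (c, d) \<in> idx n' \<and> (e, g) \<in> idx l
     then deriv (\<lambda>z. f (n + n') l
                   (upper_block X (scalar_mat (z \<cdot>\<^sub>m matrix_unit n n' b c)) X') Y
                   (a, n + d) (e, g)) 0
     else 0)"

definition id_partial :: "'a::unital_cstar_algebra family2 \<Rightarrow> 'a family3" where
  "id_partial f l n n' Y X X' = (\<lambda>(e, g) (a, b) (c, d).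
     if (e, g) \<in> idx l \<and> (a, b) \<in> idx n \<and> (c, d) \<in> idx n'
     then deriv (\<lambda>z. f l (n + n') Y
                   (upper_block X (scalar_mat (z \<cdot>\<^sub>m matrix_unit n n' b c)) X')
                   (e, g) (a, n + d)) 0
     else 0)"

end

theory Submission
  imports Defs
begin

text \<open>
  The three properties of a noncommutative function \<open>\<phi>\<close> of one variable that carry the proof all
  come from one fact: \<open>\<phi>\<close> is compatible with direct sums and similarities if and only if
  \<open>X S = S Y\<close> implies \<open>\<phi>(X) S = S \<phi>(Y)\<close> for every rectangular scalar matrix \<open>S\<close>
  (\<open>nc_fun_respects_intertwiners\<close>, \<open>respects_intertwiners_nc_fun\<close>).

  First, \<open>\<phi>\<close> maps the upper triangular matrix with diagonal blocks \<open>X\<close>, \<open>Y\<close> and corner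
  \<open>\<gamma> \<otimes> 1\<close> to an upper triangular matrix with diagonal blocks \<open>\<phi>(X)\<close>, \<open>\<phi>(Y)\<close>
  (\<open>nc_upper_block\<close>). Secondly, its corner \<open>\<Delta>(\<gamma>)\<close> satisfies \<open>\<Delta>(\<gamma>) T = S \<Delta>'(\<gamma>')\<close>
  whenever \<open>X S = S X'\<close>, \<open>Y T = T Y'\<close> and \<open>S \<gamma>' = \<gamma> T\<close> (\<open>corner_intertwines\<close>), because
  \<open>S \<oplus> T\<close> then intertwines the two triangular matrices. Thirdly, special choices of \<open>S\<close> and \<open>T\<close>
  show that \<open>\<Delta>\<close> is linear in \<open>\<gamma>\<close> and that its coefficients at the matrix units are again
  noncommutative functions of \<open>X\<close> and of \<open>Y\<close>.

  Linearity makes the derivative at \<open>0\<close> in the definition of \<open>\<partial> \<otimes> id\<close> equal to the value of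
  \<open>\<Delta>\<close> at a matrix unit (\<open>partial_id_corner\<close>), and multiplying out \<open>f # Z\<close> at a triangular
  argument shows that the same coefficients solve the identity defining the directional operator
  (\<open>lin_of_upper_block_first\<close>). The solution is unique because every scalar direction is
  admissible for every \<open>r\<close> (\<open>open_fully_matricial_nc_domain\<close>), and a tensor is determined by
  its bilinear map (\<open>tensor_of_bilinear_eqI\<close>). For \<open>id \<otimes> \<partial>\<close>, the properties of the coefficients
  follow by exchanging the two variables of \<open>f\<close>.
\<close>

section \<open>Scalar and block matrices\<close>

lemma scaleC_zero_left: "0 *\<^sub>C (x::'a::unital_cstar_algebra) = 0"
  using scaleC_of_real[of 0 x] by simp

lemma scaleC_zero_right: "c *\<^sub>C (0::'a::unital_cstar_algebra) = 0"
  by (metis mult_zero_right scaleC_scaleC scaleC_zero_left)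

lemma scaleC_one: "1 *\<^sub>C (x::'a::unital_cstar_algebra) = x"
  using scaleC_of_real[of 1 x] by simp

lemma scaleC_sum_left:
  "(\<Sum>i\<in>A. f i) *\<^sub>C (x::'a::unital_cstar_algebra) = (\<Sum>i\<in>A. f i *\<^sub>C x)"
  by (induction A rule: infinite_finite_induct) (auto simp: scaleC_zero_left scaleC_add_left)

lemma scaleC_one_mult: "(a *\<^sub>C 1) * (b *\<^sub>C 1) = (a * b) *\<^sub>C (1::'a::unital_cstar_algebra)"
  by (simp add: mult_scaleC_left scaleC_scaleC)

lemma scalar_mat_dim [simp]: "dim_row (scalar_mat s) = dim_row s" "dim_col (scalar_mat s) = dim_col s"
  unfolding scalar_mat_def by (rule index_map_mat)+

lemma scalar_mat_carrier [simp]: "scalar_mat s \<in> carrier_mat n m \<longleftrightarrow> s \<in> carrier_mat n m"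
  unfolding carrier_mat_def by simp

lemma scalar_mat_mult:
  assumes "s \<in> carrier_mat n k" "t \<in> carrier_mat k m"
  shows "scalar_mat (s * t) = scalar_mat s * scalar_mat t"
proof (rule eq_matI)
  fix i j
  assume "i < dim_row (scalar_mat s * scalar_mat t)" "j < dim_col (scalar_mat s * scalar_mat t)"
  hence ij: "i < n" "j < m" using assms by auto
  have "scalar_mat (s * t) $$ (i, j) = (\<Sum>l\<in>{0..<k}. s $$ (i, l) * t $$ (l, j)) *\<^sub>C 1"
    using assms ij by (simp add: scalar_mat_def scalar_prod_def)
  also have "\<dots> = (\<Sum>l\<in>{0..<k}. (s $$ (i, l) *\<^sub>C 1) * (t $$ (l, j) *\<^sub>C 1))"
    by (simp only: scaleC_sum_left scaleC_one_mult)
  also have "\<dots> = (scalar_mat s * scalar_mat t) $$ (i, j)"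
    using assms ij by (simp add: scalar_mat_def scalar_prod_def)
  finally show "scalar_mat (s * t) $$ (i, j) = (scalar_mat s * scalar_mat t) $$ (i, j)" .
qed (use assms in auto)

lemma scalar_mat_one [simp]: "scalar_mat (1\<^sub>m n) = 1\<^sub>m n"
  by (rule eq_matI) (auto simp: scalar_mat_def scaleC_zero_left scaleC_one)

lemma scalar_mat_zero [simp]: "scalar_mat (0\<^sub>m n m) = 0\<^sub>m n m"
  by (rule eq_matI) (auto simp: scalar_mat_def scaleC_zero_left)

lemma scalar_mat_four_block:
  assumes "A \<in> carrier_mat r1 c1" "B \<in> carrier_mat r1 c2"
    "C \<in> carrier_mat r2 c1" "D \<in> carrier_mat r2 c2"
  shows "scalar_mat (four_block_mat A B C D) =
    four_block_mat (scalar_mat A) (scalar_mat B) (scalar_mat C) (scalar_mat D)"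
  unfolding scalar_mat_def by (rule map_four_block_mat[OF assms])

lemma scalar_mat_append_rows:
  assumes "A \<in> carrier_mat n1 m" "B \<in> carrier_mat n2 m"
  shows "scalar_mat (A @\<^sub>r B) = scalar_mat A @\<^sub>r scalar_mat B"
  using assms by (intro eq_matI) (auto simp: append_rows_def scalar_mat_def)

lemma zero_add_mat_dim [simp]:
  "dim_row A = n \<Longrightarrow> dim_col A = m \<Longrightarrow> 0\<^sub>m n m + (A :: 'b::monoid_add mat) = A"
  "dim_row A = n \<Longrightarrow> dim_col A = m \<Longrightarrow> A + 0\<^sub>m n m = A"
  by (auto intro!: eq_matI)

lemma append_rows_mult:
  fixes A :: "'b::semiring_0 mat"
  assumes "A \<in> carrier_mat n1 k" "B \<in> carrier_mat n2 k" "C \<in> carrier_mat k m"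
  shows "(A @\<^sub>r B) * C = (A * C) @\<^sub>r (B * C)"
  using assms by (intro eq_matI) (auto simp: append_rows_def scalar_prod_def)

lemma four_block_mult_append_rows:
  fixes A :: "'b::semiring_0 mat"
  assumes "A \<in> carrier_mat n1 k1" "B \<in> carrier_mat n1 k2"
    "C \<in> carrier_mat n2 k1" "D \<in> carrier_mat n2 k2"
    "E \<in> carrier_mat k1 m" "F \<in> carrier_mat k2 m"
  shows "four_block_mat A B C D * (E @\<^sub>r F) = (A * E + B * F) @\<^sub>r (C * E + D * F)"
proof -
  have "four_block_mat A B C D * four_block_mat E (0\<^sub>m k1 0) F (0\<^sub>m k2 0) =
      four_block_mat (A * E + B * F) (A * 0\<^sub>m k1 0 + B * 0\<^sub>m k2 0)
        (C * E + D * F) (C * 0\<^sub>m k1 0 + D * 0\<^sub>m k2 0)"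
    using assms by (intro mult_four_block_mat) auto
  moreover have "A * 0\<^sub>m k1 0 + B * 0\<^sub>m k2 0 = 0\<^sub>m n1 0" "C * 0\<^sub>m k1 0 + D * 0\<^sub>m k2 0 = 0\<^sub>m n2 0"
    using assms by auto
  ultimately show ?thesis using assms by (simp add: append_rows_def)
qed

lemma upper_triangular_mult:
  fixes A :: "'b::semiring_0 mat"
  assumes "A \<in> carrier_mat n1 k1" "B \<in> carrier_mat n1 k2" "D \<in> carrier_mat n2 k2"
    "A' \<in> carrier_mat k1 m1" "B' \<in> carrier_mat k1 m2" "D' \<in> carrier_mat k2 m2"
  shows "four_block_mat A B (0\<^sub>m n2 k1) D * four_block_mat A' B' (0\<^sub>m k2 m1) D' =
    four_block_mat (A * A') (A * B' + B * D') (0\<^sub>m n2 m1) (D * D')"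
proof -
  have "four_block_mat A B (0\<^sub>m n2 k1) D * four_block_mat A' B' (0\<^sub>m k2 m1) D' =
      four_block_mat (A * A' + B * 0\<^sub>m k2 m1) (A * B' + B * D')
        (0\<^sub>m n2 k1 * A' + D * 0\<^sub>m k2 m1) (0\<^sub>m n2 k1 * B' + D * D')"
    using assms by (intro mult_four_block_mat) auto
  thus ?thesis using assms by simp
qed

lemma append_rows_eq_iff:
  assumes "A \<in> carrier_mat n1 m" "B \<in> carrier_mat n2 m"
    "A' \<in> carrier_mat n1 m" "B' \<in> carrier_mat n2 m"
  shows "A @\<^sub>r B = A' @\<^sub>r B' \<longleftrightarrow> A = A' \<and> B = B'"
proof
  assume eq: "A @\<^sub>r B = A' @\<^sub>r B'"
  have "A $$ (i, j) = A' $$ (i, j)" if "i < n1" "j < m" for i j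
    using arg_cong[OF eq, of "\<lambda>M. M $$ (i, j)"] that assms by (auto simp: append_rows_def)
  moreover have "B $$ (i, j) = B' $$ (i, j)" if "i < n2" "j < m" for i j
    using arg_cong[OF eq, of "\<lambda>M. M $$ (n1 + i, j)"] that assms by (auto simp: append_rows_def)
  ultimately show "A = A' \<and> B = B'" using assms by (auto intro!: eq_matI)
qed auto

lemma four_block_mat_eq_iff:
  assumes "A \<in> carrier_mat n1 m1" "B \<in> carrier_mat n1 m2"
    "C \<in> carrier_mat n2 m1" "D \<in> carrier_mat n2 m2"
    "A' \<in> carrier_mat n1 m1" "B' \<in> carrier_mat n1 m2"
    "C' \<in> carrier_mat n2 m1" "D' \<in> carrier_mat n2 m2"
  shows "four_block_mat A B C D = four_block_mat A' B' C' D' \<longleftrightarrow>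
    A = A' \<and> B = B' \<and> C = C' \<and> D = D'"
proof
  assume eq: "four_block_mat A B C D = four_block_mat A' B' C' D'"
  have "A $$ (i, j) = A' $$ (i, j)" if "i < n1" "j < m1" for i j
    using arg_cong[OF eq, of "\<lambda>M. M $$ (i, j)"] that assms by auto
  moreover have "B $$ (i, j) = B' $$ (i, j)" if "i < n1" "j < m2" for i j
    using arg_cong[OF eq, of "\<lambda>M. M $$ (i, m1 + j)"] that assms by auto
  moreover have "C $$ (i, j) = C' $$ (i, j)" if "i < n2" "j < m1" for i j
    using arg_cong[OF eq, of "\<lambda>M. M $$ (n1 + i, j)"] that assms by auto
  moreover have "D $$ (i, j) = D' $$ (i, j)" if "i < n2" "j < m2" for i j
    using arg_cong[OF eq, of "\<lambda>M. M $$ (n1 + i, m1 + j)"] that assms by auto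
  ultimately show "A = A' \<and> B = B' \<and> C = C' \<and> D = D'" using assms by (auto intro!: eq_matI)
qed auto

lemma upper_block_four_block:
  assumes "X \<in> carrier_mat n n" "Z \<in> carrier_mat n m" "Y \<in> carrier_mat m m"
  shows "upper_block X Z Y = four_block_mat X Z (0\<^sub>m m n) Y"
  using assms unfolding upper_block_def by auto

lemma dsum_four_block:
  assumes "X \<in> carrier_mat n n" "Y \<in> carrier_mat m m"
  shows "dsum X Y = four_block_mat X (0\<^sub>m n m) (0\<^sub>m m n) Y"
    and "dsum X Y = upper_block X (0\<^sub>m n m) Y"
  using assms by (auto simp: dsum_def upper_block_def)

lemma matrix_unit_carrier [simp]: "matrix_unit n m i j \<in> carrier_mat n m"
  by (simp add: matrix_unit_def)

lemma matrix_unit_index [simp]: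
  "b < n \<Longrightarrow> c < m \<Longrightarrow> matrix_unit n m i j $$ (b, c) = (if b = i \<and> c = j then 1 else 0)"
  "dim_row (matrix_unit n m i j) = n" "dim_col (matrix_unit n m i j) = m"
  by (simp_all add: matrix_unit_def)

lemma append_cols_mult_append_rows:
  fixes A :: "'b::semiring_0 mat"
  assumes "A \<in> carrier_mat n k1" "B \<in> carrier_mat n k2" "C \<in> carrier_mat k1 m" "D \<in> carrier_mat k2 m"
  shows "(A @\<^sub>h B) * (C @\<^sub>r D) = A * C + B * D"
proof -
  have "(A @\<^sub>h B) * (C @\<^sub>r D) = (A * C + B * D) @\<^sub>r (0\<^sub>m 0 k1 * C + 0\<^sub>m 0 k2 * D)"
    using assms unfolding append_cols_mat_def
    by (subst four_block_mult_append_rows[of _ n k1 _ k2 _ 0 _ _ m]) auto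
  also have "\<dots> = A * C + B * D"
    using assms by (intro eq_matI) (auto simp: append_rows_def)
  finally show ?thesis .
qed

lemma append_cols_carrier [simp, intro]:
  "A \<in> carrier_mat n m1 \<Longrightarrow> B \<in> carrier_mat n m2 \<Longrightarrow> A @\<^sub>h B \<in> carrier_mat n (m1 + m2)"
  unfolding append_cols_mat_def by auto

text \<open>A linear functional on matrices is determined by its values at the matrix units.\<close>

lemma linear_functional_matrix_units:
  fixes L :: "complex mat \<Rightarrow> complex"
  assumes add: "\<And>A B. A \<in> carrier_mat n m \<Longrightarrow> B \<in> carrier_mat n m \<Longrightarrow> L (A + B) = L A + L B"
    and smult: "\<And>c A. A \<in> carrier_mat n m \<Longrightarrow> L (c \<cdot>\<^sub>m A) = c * L A"
    and A: "A \<in> carrier_mat n m"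
  shows "L A = (\<Sum>b<n. \<Sum>c<m. A $$ (b, c) * L (matrix_unit n m b c))"
proof -
  define R where "R I = mat n m (\<lambda>u. if u \<in> I then A $$ u else 0)" for I
  have R: "L (R I) = (\<Sum>(b, c)\<in>I. A $$ (b, c) * L (matrix_unit n m b c))"
    if "finite I" "I \<subseteq> {..<n} \<times> {..<m}" for I
    using that
  proof (induction I rule: finite_induct)
    case empty
    have "R {} = 0 \<cdot>\<^sub>m 0\<^sub>m n m" by (rule eq_matI) (auto simp: R_def)
    thus ?case using smult[of "0\<^sub>m n m" 0] by simp
  next
    case (insert u I)
    obtain b c where u: "u = (b, c)" by fastforce
    have "R (insert u I) = R I + A $$ u \<cdot>\<^sub>m matrix_unit n m b c"
      using insert.hyps by (intro eq_matI) (auto simp: R_def u)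
    hence "L (R (insert u I)) = L (R I) + A $$ u * L (matrix_unit n m b c)"
      using add[of "R I" "A $$ u \<cdot>\<^sub>m matrix_unit n m b c"] smult[of "matrix_unit n m b c" "A $$ u"]
      by (simp add: R_def)
    thus ?case using insert by (simp add: u)
  qed
  have "R ({..<n} \<times> {..<m}) = A" using A by (intro eq_matI) (auto simp: R_def)
  thus ?thesis using R[of "{..<n} \<times> {..<m}"] by (simp add: sum.cartesian_product)
qed

lemma scalar_mat_smult_one_commute:
  assumes "Y \<in> carrier_mat m m"
  shows "Y * scalar_mat (c \<cdot>\<^sub>m 1\<^sub>m m) = scalar_mat (c \<cdot>\<^sub>m 1\<^sub>m m) * Y"
proof (rule eq_matI)
  fix i j assume "i < dim_row (scalar_mat (c \<cdot>\<^sub>m 1\<^sub>m m) * Y)" "j < dim_col (scalar_mat (c \<cdot>\<^sub>m 1\<^sub>m m) * Y)"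
  hence ij: "i < m" "j < m" using assms by auto
  have "(Y * scalar_mat (c \<cdot>\<^sub>m 1\<^sub>m m)) $$ (i, j) =
      (\<Sum>k\<in>{0..<m}. if k = j then c *\<^sub>C (Y $$ (i, k)) else 0)"
    using assms ij
    by (simp add: scalar_mat_def scalar_prod_def mult_scaleC_right scaleC_zero_left mult_delta_left mult_delta_right
        if_distrib[of "\<lambda>z. z *\<^sub>C _"] cong: if_cong)
  also have "\<dots> = c *\<^sub>C (Y $$ (i, j))" using ij by simp
  also have "\<dots> = (\<Sum>k\<in>{0..<m}. if i = k then c *\<^sub>C (Y $$ (k, j)) else 0)" using ij by simp
  also have "\<dots> = (scalar_mat (c \<cdot>\<^sub>m 1\<^sub>m m) * Y) $$ (i, j)"
    using assms ij
    by (simp add: scalar_mat_def scalar_prod_def mult_scaleC_left scaleC_zero_left mult_delta_left mult_delta_right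
        if_distrib[of "\<lambda>z. z *\<^sub>C _"] cong: if_cong)
  finally show "(Y * scalar_mat (c \<cdot>\<^sub>m 1\<^sub>m m)) $$ (i, j) = (scalar_mat (c \<cdot>\<^sub>m 1\<^sub>m m) * Y) $$ (i, j)" .
qed (use assms in auto)

lemma append_cols_eq_iff:
  assumes "A \<in> carrier_mat n m1" "B \<in> carrier_mat n m2"
    "A' \<in> carrier_mat n m1" "B' \<in> carrier_mat n m2"
  shows "A @\<^sub>h B = A' @\<^sub>h B' \<longleftrightarrow> A = A' \<and> B = B'"
  using assms four_block_mat_eq_iff[of A n m1 B m2 "0\<^sub>m 0 m1" 0 "0\<^sub>m 0 m2" A' B' "0\<^sub>m 0 m1" "0\<^sub>m 0 m2"]
  unfolding append_cols_mat_def by simp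

lemma add_mat_left_cancel:
  fixes A :: "'b::ring_1 mat"
  assumes "A \<in> carrier_mat n m" "B \<in> carrier_mat n m" "C \<in> carrier_mat n m"
    and eq: "A + 1 \<cdot>\<^sub>m B = A + 1 \<cdot>\<^sub>m C"
  shows "B = C"
proof (rule eq_matI)
  fix i j assume "i < dim_row C" "j < dim_col C"
  thus "B $$ (i, j) = C $$ (i, j)"
    using arg_cong[OF eq, of "\<lambda>M. M $$ (i, j)"] assms(1-3) by simp
qed (use assms in auto)

section \<open>Tensor coefficients\<close>

lemma sum_lessThan_add:
  "(\<Sum>j<n + m. g j) = (\<Sum>j<n. g j) + (\<Sum>l<m. g (n + l) :: 'b::comm_monoid_add)" for n m :: nat
  by (induction m) (auto simp: add.assoc)

lemma sum_swap_pairs: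
  fixes h :: "'i \<Rightarrow> 'j \<Rightarrow> 'k \<Rightarrow> 'l \<Rightarrow> 'b::comm_monoid_add"
  shows "(\<Sum>j\<in>A. \<Sum>k\<in>B. \<Sum>l\<in>C. \<Sum>p\<in>D. h j k l p) = (\<Sum>l\<in>C. \<Sum>p\<in>D. \<Sum>j\<in>A. \<Sum>k\<in>B. h j k l p)"
proof -
  have pairs: "(\<Sum>j\<in>A. \<Sum>k\<in>B. F j k) = (\<Sum>u\<in>A \<times> B. F (fst u) (snd u))" for F :: "'i \<Rightarrow> 'j \<Rightarrow> 'b"
    by (simp add: sum.cartesian_product case_prod_unfold)
  have "(\<Sum>j\<in>A. \<Sum>k\<in>B. \<Sum>l\<in>C. \<Sum>p\<in>D. h j k l p) =
      (\<Sum>u\<in>A \<times> B. \<Sum>l\<in>C. \<Sum>p\<in>D. h (fst u) (snd u) l p)"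
    by (rule pairs)
  also have "\<dots> = (\<Sum>l\<in>C. \<Sum>u\<in>A \<times> B. \<Sum>p\<in>D. h (fst u) (snd u) l p)"
    by (rule sum.swap)
  also have "\<dots> = (\<Sum>l\<in>C. \<Sum>p\<in>D. \<Sum>u\<in>A \<times> B. h (fst u) (snd u) l p)"
    by (intro sum.cong refl sum.swap)
  also have "\<dots> = (\<Sum>l\<in>C. \<Sum>p\<in>D. \<Sum>j\<in>A. \<Sum>k\<in>B. h j k l p)"
    by (intro sum.cong refl pairs[symmetric])
  finally show ?thesis .
qed

lemma sum_matrix_unit:
  assumes "a < n" "b < m"
  shows "(\<Sum>j<n. \<Sum>k<m. g j k * matrix_unit n m a b $$ (j, k)) = g a b"
proof -
  have "(\<Sum>j<n. \<Sum>k<m. g j k * matrix_unit n m a b $$ (j, k)) =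
      (\<Sum>j<n. if j = a then (\<Sum>k<m. if k = b then g a k else 0) else 0)"
    using assms by (intro sum.cong) (auto simp: mult_delta_right)
  also have "\<dots> = g a b" using assms by simp
  finally show ?thesis .
qed

lemma sharp3_matrix_units:
  assumes "i < n1" "j < n1" "k < n2" "l < n2" "p < n3" "q < n3"
  shows "sharp3 n1 n2 n3 T (matrix_unit n1 n2 j k) (matrix_unit n2 n3 l p) $$ (i, q) = T (i, j) (k, l) (p, q)"
  using assms by (simp add: sharp3_def sum_matrix_unit del: matrix_unit_index)

lemma tensor_of_bilinear_eqI:
  assumes T: "T \<in> tens3 n1 n2 n3"
    and B: "\<And>Z1 Z2. Z1 \<in> carrier_mat n1 n2 \<Longrightarrow> Z2 \<in> carrier_mat n2 n3 \<Longrightarrow> B Z1 Z2 = sharp3 n1 n2 n3 T Z1 Z2"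
  shows "tensor_of_bilinear n1 n2 n3 B = T"
  unfolding tensor_of_bilinear_def
proof (rule the_equality)
  show "T \<in> tens3 n1 n2 n3 \<and>
     (\<forall>Z1\<in>carrier_mat n1 n2. \<forall>Z2\<in>carrier_mat n2 n3. sharp3 n1 n2 n3 T Z1 Z2 = B Z1 Z2)"
    using T B by simp
next
  fix T' assume T': "T' \<in> tens3 n1 n2 n3 \<and>
     (\<forall>Z1\<in>carrier_mat n1 n2. \<forall>Z2\<in>carrier_mat n2 n3. sharp3 n1 n2 n3 T' Z1 Z2 = B Z1 Z2)"
  have "T' (i, j) (k, l) (p, q) = T (i, j) (k, l) (p, q)" for i j k l p q
  proof (cases "(i, j) \<in> idx n1 \<and> (k, l) \<in> idx n2 \<and> (p, q) \<in> idx n3")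
    case True
    hence "i < n1" "j < n1" "k < n2" "l < n2" "p < n3" "q < n3" by (auto simp: idx_def)
    have "sharp3 n1 n2 n3 T' (matrix_unit n1 n2 j k) (matrix_unit n2 n3 l p) =
        sharp3 n1 n2 n3 T (matrix_unit n1 n2 j k) (matrix_unit n2 n3 l p)"
      using T' B by simp
    thus ?thesis
      using sharp3_matrix_units[of i n1 j k n2 l p n3 q T] sharp3_matrix_units[of i n1 j k n2 l p n3 q T']
        True by (simp add: idx_def)
  next
    case False
    with T T' have "T' (i, j) (k, l) (p, q) = 0" "T (i, j) (k, l) (p, q) = 0"
      unfolding tens3_def by blast+
    thus ?thesis by simp
  qed
  thus "T' = T" by (intro ext) auto
qed

text \<open>The matrix-valued function of the first variable obtained from a family by fixing the second
  variable and a matrix unit in the second tensor leg.\<close>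

definition slice1 ::
  "'a::unital_cstar_algebra family2 \<Rightarrow> nat \<Rightarrow> 'a mat \<Rightarrow> nat \<times> nat \<Rightarrow> nat \<Rightarrow> 'a mat \<Rightarrow> complex mat" where
  "slice1 f m Y v = (\<lambda>n X. mat n n (\<lambda>u. f n m X Y u v))"

text \<open>The family with its two variables, and correspondingly its two tensor legs, exchanged.\<close>

definition swap2 :: "'a::unital_cstar_algebra family2 \<Rightarrow> 'a family2" where
  "swap2 f = (\<lambda>n m X Y u v. f m n Y X v u)"

lemma swap2_nc2:
  assumes "f \<in> nc2 \<Omega>"
  shows "swap2 f \<in> nc2 \<Omega>"
  using assms by (simp add: nc2_def swap2_def tens2_def)

lemma id_partial_swap2:
  "id_partial f l n n' Y X X' u v w = partial_id (swap2 f) n n' l X X' Y v w u"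
  by (cases u; cases v; cases w) (simp add: id_partial_def partial_id_def swap2_def)

text \<open>Permuting the variables together with the tensor legs preserves noncommutative families.\<close>

lemma nc3_rotate:
  assumes "g \<in> nc3 \<Omega>"
  shows "(\<lambda>l n n' Y X X' u v w. g n n' l X X' Y v w u) \<in> nc3 \<Omega>"
  unfolding nc3_def
proof (intro CollectI conjI allI ballI)
  fix l n n' Y X X' assume "Y \<in> \<Omega> l" "X \<in> \<Omega> n" "X' \<in> \<Omega> n'"
  hence "g n n' l X X' Y \<in> tens3 n n' l" using assms by (simp add: nc3_def)
  thus "(\<lambda>u v w. g n n' l X X' Y v w u) \<in> tens3 l n n'" unfolding tens3_def by blast
qed (use assms in \<open>simp_all add: nc3_def\<close>)

lemma lin_of_carrier [simp]: "lin_of f n m X Y Z \<in> carrier_mat n m"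
  by (simp add: lin_of_def sharp2_def)

lemma lin_of_dim [simp]:
  "dim_row (lin_of f n m X Y Z) = n" "dim_col (lin_of f n m X Y Z) = m"
  by (simp_all add: lin_of_def sharp2_def)

lemma lin_of_index:
  "i < n \<Longrightarrow> q < m \<Longrightarrow> lin_of f n m X Y Z $$ (i, q) = (\<Sum>j<n. \<Sum>p<m. f n m X Y (i, j) (p, q) * Z $$ (j, p))"
  by (simp add: lin_of_def sharp2_def)

lemma sharp3_carrier [simp]: "sharp3 n1 n2 n3 T Z1 Z2 \<in> carrier_mat n1 n3"
  by (simp add: sharp3_def)

lemma sharp3_dim [simp]:
  "dim_row (sharp3 n1 n2 n3 T Z1 Z2) = n1" "dim_col (sharp3 n1 n2 n3 T Z1 Z2) = n3"
  by (simp_all add: sharp3_def)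

section \<open>Noncommutative functions and intertwining relations\<close>

lemma nc_funD:
  assumes "nc_fun \<Omega> \<phi>" "X \<in> \<Omega> n"
  shows "Y \<in> \<Omega> m \<Longrightarrow> \<phi> (n + m) (dsum X Y) = dsum (\<phi> n X) (\<phi> m Y)"
    and "(s, t) \<in> GL n \<Longrightarrow> \<phi> n (scalar_mat s * X * scalar_mat t) = s * \<phi> n X * t"
  using assms unfolding nc_fun_def by (simp, fastforce)

text \<open>The properties of a fully matricial set that the difference-differential calculus needs. The
  last one is right admissibility in scalar directions, in the strong form that every multiple of
  the direction is admissible.\<close>

locale nc_domain =
  fixes \<Omega> :: "nat \<Rightarrow> 'a::unital_cstar_algebra mat set"
  assumes square: "X \<in> \<Omega> n \<Longrightarrow> X \<in> carrier_mat n n"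
    and similar: "X \<in> \<Omega> n \<Longrightarrow> (s, t) \<in> GL n \<Longrightarrow> scalar_mat s * X * scalar_mat t \<in> \<Omega> n"
    and upper_block_mem: "X \<in> \<Omega> n \<Longrightarrow> Y \<in> \<Omega> m \<Longrightarrow> \<gamma> \<in> carrier_mat n m \<Longrightarrow>
      upper_block X (scalar_mat \<gamma>) Y \<in> \<Omega> (n + m)"
begin

lemma dsum_mem:
  assumes "X \<in> \<Omega> n" "Y \<in> \<Omega> m"
  shows "dsum X Y \<in> \<Omega> (n + m)"
  using upper_block_mem[OF assms zero_carrier_mat] dsum_four_block(2)[OF assms[THEN square]] by simp

text \<open>A matrix-valued graded function (square matrices of size \<open>n\<close> at level \<open>n\<close>) that preserves every
  intertwining relation \<open>X S = S Y\<close> with \<open>S\<close> a scalar matrix, not necessarily square.\<close>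

definition respects_intertwiners :: "(nat \<Rightarrow> 'a mat \<Rightarrow> complex mat) \<Rightarrow> bool" where
  "respects_intertwiners \<phi> \<longleftrightarrow> (\<forall>n. \<forall>X\<in>\<Omega> n. \<phi> n X \<in> carrier_mat n n) \<and> (\<forall>n m. \<forall>X\<in>\<Omega> n. \<forall>Y\<in>\<Omega> m. \<forall>S\<in>carrier_mat n m.
     X * scalar_mat S = scalar_mat S * Y \<longrightarrow> \<phi> n X * S = S * \<phi> m Y)"

lemma respects_intertwiners_carrier:
  "respects_intertwiners \<phi> \<Longrightarrow> X \<in> \<Omega> n \<Longrightarrow> \<phi> n X \<in> carrier_mat n n"
  by (simp add: respects_intertwiners_def)

lemma respects_intertwinersD:
  "respects_intertwiners \<phi> \<Longrightarrow> X \<in> \<Omega> n \<Longrightarrow> Y \<in> \<Omega> m \<Longrightarrow> S \<in> carrier_mat n m \<Longrightarrow>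
    X * scalar_mat S = scalar_mat S * Y \<Longrightarrow> \<phi> n X * S = S * \<phi> m Y"
  by (simp add: respects_intertwiners_def)

text \<open>If \<open>X S = S Y\<close>, then \<open>X \<oplus> Y\<close> commutes with the unipotent matrix \<open>s\<close> having \<open>S\<close> in its
  corner. Hence so does \<open>\<phi>(X) \<oplus> \<phi>(Y)\<close>, and the corner of that relation is the claim.\<close>

lemma nc_fun_respects_intertwiners:
  assumes nc: "nc_fun \<Omega> \<phi>" and car: "\<And>n X. X \<in> \<Omega> n \<Longrightarrow> \<phi> n X \<in> carrier_mat n n"
  shows "respects_intertwiners \<phi>"
  unfolding respects_intertwiners_def
proof (intro conjI allI ballI impI)
  show "\<phi> n X \<in> carrier_mat n n" if "X \<in> \<Omega> n" for n X using that by (rule car)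
next
  fix n m X Y and S :: "complex mat"
  assume X: "X \<in> \<Omega> n" and Y: "Y \<in> \<Omega> m" and S [simp]: "S \<in> carrier_mat n m"
    and eq: "X * scalar_mat S = scalar_mat S * Y"
  note [simp] = carrier_matD[OF S]
  note [simp] = X[THEN square] Y[THEN square] X[THEN car] Y[THEN car]
  note [simp] = this[THEN carrier_matD(1)] this[THEN carrier_matD(2)]
  define s where "s = four_block_mat (1\<^sub>m n) S (0\<^sub>m m n) (1\<^sub>m m)"
  define t where "t = four_block_mat (1\<^sub>m n) (- S) (0\<^sub>m m n) (1\<^sub>m m)"
  have s [simp]: "s \<in> carrier_mat (n + m) (n + m)" and t [simp]: "t \<in> carrier_mat (n + m) (n + m)"
    by (auto simp: s_def t_def)
  have S': "- S \<in> carrier_mat n m" using S by simp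
  have minus_r_inv: "S + - S = 0\<^sub>m n m" by (rule eq_matI) auto
  have "s * t = 1\<^sub>m (n + m)"
    unfolding s_def t_def
    by (subst upper_triangular_mult[OF one_carrier_mat S one_carrier_mat one_carrier_mat S' one_carrier_mat])
      (simp add: left_mult_one_mat[OF S'] right_mult_one_mat[OF S] uminus_l_inv_mat[OF S])
  moreover have "t * s = 1\<^sub>m (n + m)"
    unfolding s_def t_def
    by (subst upper_triangular_mult[OF one_carrier_mat S' one_carrier_mat one_carrier_mat S one_carrier_mat])
      (simp add: left_mult_one_mat[OF S] right_mult_one_mat[OF S'] minus_r_inv)
  ultimately have st: "s * t = 1\<^sub>m (n + m)" and ts: "t * s = 1\<^sub>m (n + m)" by auto
  have GL: "(s, t) \<in> GL (n + m)" using st ts by (simp add: GL_def)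
  define D where "D = dsum X Y"
  define P where "P = dsum (\<phi> n X) (\<phi> m Y)"
  have D: "D \<in> \<Omega> (n + m)" unfolding D_def by (rule dsum_mem[OF X Y])
  have \<phi>D: "\<phi> (n + m) D = P" unfolding D_def P_def by (rule nc_funD(1)[OF nc X Y])
  have Dc [simp]: "D \<in> carrier_mat (n + m) (n + m)" and Pc [simp]: "P \<in> carrier_mat (n + m) (n + m)"
    using square[OF D] car[OF D] \<phi>D by auto
  note [simp] = s[THEN carrier_matD(1)] s[THEN carrier_matD(2)] Pc[THEN carrier_matD(1)] Pc[THEN carrier_matD(2)]
  have ss: "scalar_mat s = four_block_mat (1\<^sub>m n) (scalar_mat S) (0\<^sub>m m n) (1\<^sub>m m)"
    unfolding s_def by (subst scalar_mat_four_block[of _ n n _ m _ m]) auto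
  have Db: "D = four_block_mat X (0\<^sub>m n m) (0\<^sub>m m n) Y"
    unfolding D_def by (rule dsum_four_block(1)) auto
  have "scalar_mat s * D = four_block_mat X (scalar_mat S * Y) (0\<^sub>m m n) Y"
    unfolding ss Db by (subst upper_triangular_mult[of _ n n _ m _ m _ n _ m]) auto
  also have "\<dots> = D * scalar_mat s"
    unfolding ss Db by (subst upper_triangular_mult[of _ n n _ m _ m _ n _ m]) (auto simp: eq)
  finally have "scalar_mat s * D * scalar_mat t = D * (scalar_mat s * scalar_mat t)"
    by (simp add: assoc_mult_mat[of _ "n+m" "n+m" _ "n+m" _ "n+m"])
  also have "scalar_mat s * scalar_mat t = (1\<^sub>m (n + m) :: 'a mat)"
    using st scalar_mat_mult[OF s t, symmetric] by simp
  also have "D * 1\<^sub>m (n + m) = D" using Dc by (rule right_mult_one_mat)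
  finally have "s * P * t = P"
    using nc_funD(2)[OF nc D GL] \<phi>D by simp
  hence "P * s = s * P * (t * s)"
    using assoc_mult_mat[of "s * P" "n + m" "n + m" t "n + m" s "n + m"] by simp
  hence comm: "P * s = s * P" using ts by simp
  have Pb: "P = four_block_mat (\<phi> n X) (0\<^sub>m n m) (0\<^sub>m m n) (\<phi> m Y)"
    unfolding P_def by (rule dsum_four_block(1)) auto
  have "P * s = four_block_mat (\<phi> n X) (\<phi> n X * S) (0\<^sub>m m n) (\<phi> m Y)"
    unfolding s_def Pb by (subst upper_triangular_mult[of _ n n _ m _ m _ n _ m]) auto
  moreover have "s * P = four_block_mat (\<phi> n X) (S * \<phi> m Y) (0\<^sub>m m n) (\<phi> m Y)"
    unfolding s_def Pb by (subst upper_triangular_mult[of _ n n _ m _ m _ n _ m]) auto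
  ultimately show "\<phi> n X * S = S * \<phi> m Y"
    using comm four_block_mat_eq_iff[of "\<phi> n X" n n "\<phi> n X * S" m "0\<^sub>m m n" m "\<phi> m Y"
        "\<phi> n X" "S * \<phi> m Y" "0\<^sub>m m n" "\<phi> m Y"]
      mult_carrier_mat[OF X[THEN car] S] mult_carrier_mat[OF S Y[THEN car]] by auto
qed

text \<open>Conversely, a direct sum is intertwined with its summands by the two block inclusions, and a
  similarity \<open>s\<close> intertwines \<open>s X s\<inverse>\<close> with \<open>X\<close>.\<close>

lemma respects_intertwiners_nc_fun:
  assumes int: "respects_intertwiners \<phi>"
  shows "nc_fun \<Omega> \<phi>"
  unfolding nc_fun_def
proof (intro conjI allI ballI case_prodI2)
  fix m n X Y assume X: "X \<in> \<Omega> m" and Y: "Y \<in> \<Omega> n"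
  note car = respects_intertwiners_carrier[OF int]
  note [simp] = X[THEN square] Y[THEN square] X[THEN car] Y[THEN car]
  note [simp] = this[THEN carrier_matD(1)] this[THEN carrier_matD(2)]
  have D: "dsum X Y \<in> \<Omega> (m + n)" by (rule dsum_mem[OF X Y])
  obtain A B C E where ABCE: "split_block (\<phi> (m + n) (dsum X Y)) m m = (A, B, C, E)"
    by (cases "split_block (\<phi> (m + n) (dsum X Y)) m m") auto
  have [simp]: "A \<in> carrier_mat m m" "B \<in> carrier_mat m n" "C \<in> carrier_mat n m" "E \<in> carrier_mat n n"
    and \<phi>D: "\<phi> (m + n) (dsum X Y) = four_block_mat A B C E"
    using split_block[OF ABCE] car[OF D] by auto
  note [simp] = this(1-4)[THEN carrier_matD(1)] this(1-4)[THEN carrier_matD(2)]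
  have Db: "dsum X Y = four_block_mat X (0\<^sub>m m n) (0\<^sub>m n m) Y"
    by (rule dsum_four_block(1)) auto
  define i1 where "i1 = 1\<^sub>m m @\<^sub>r (0\<^sub>m n m :: complex mat)"
  define i2 where "i2 = 0\<^sub>m m n @\<^sub>r (1\<^sub>m n :: complex mat)"
  have s1: "scalar_mat i1 = 1\<^sub>m m @\<^sub>r 0\<^sub>m n m"
    unfolding i1_def by (subst scalar_mat_append_rows[of _ m m _ n]) auto
  have s2: "scalar_mat i2 = 0\<^sub>m m n @\<^sub>r 1\<^sub>m n"
    unfolding i2_def by (subst scalar_mat_append_rows[of _ m n _ n]) auto
  have "dsum X Y * scalar_mat i1 = scalar_mat i1 * X"
    unfolding Db s1
    by (subst four_block_mult_append_rows[of _ m m _ n _ n _ _ m], simp_all,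
        subst append_rows_mult[of _ m m _ n _ m], simp_all)
  hence "\<phi> (m + n) (dsum X Y) * i1 = i1 * \<phi> m X"
    by (intro respects_intertwinersD[OF int D X]) (auto simp: i1_def)
  moreover have "\<phi> (m + n) (dsum X Y) * i1 = A @\<^sub>r C"
    unfolding i1_def \<phi>D by (subst four_block_mult_append_rows[of _ m m _ n _ n _ _ m]) simp_all
  moreover have "i1 * \<phi> m X = \<phi> m X @\<^sub>r 0\<^sub>m n m"
    unfolding i1_def by (subst append_rows_mult[of _ m m _ n _ m]) simp_all
  ultimately have 1: "A = \<phi> m X \<and> C = 0\<^sub>m n m"
    by (subst append_rows_eq_iff[of _ m m _ n, symmetric]) auto
  have "dsum X Y * scalar_mat i2 = scalar_mat i2 * Y"
    unfolding Db s2
    by (subst four_block_mult_append_rows[of _ m m _ n _ n _ _ n], simp_all,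
        subst append_rows_mult[of _ m n _ n _ n], simp_all)
  hence "\<phi> (m + n) (dsum X Y) * i2 = i2 * \<phi> n Y"
    by (intro respects_intertwinersD[OF int D Y]) (auto simp: i2_def)
  moreover have "\<phi> (m + n) (dsum X Y) * i2 = B @\<^sub>r E"
    unfolding i2_def \<phi>D by (subst four_block_mult_append_rows[of _ m m _ n _ n _ _ n]) simp_all
  moreover have "i2 * \<phi> n Y = 0\<^sub>m m n @\<^sub>r \<phi> n Y"
    unfolding i2_def by (subst append_rows_mult[of _ m n _ n _ n]) simp_all
  ultimately have 2: "B = 0\<^sub>m m n \<and> E = \<phi> n Y"
    by (subst append_rows_eq_iff[of _ m n _ n, symmetric]) auto
  show "\<phi> (m + n) (dsum X Y) = dsum (\<phi> m X) (\<phi> n Y)"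
    using 1 2 \<phi>D by (simp add: dsum_four_block(1)[of _ m _ n])
next
  fix n X p s t assume X: "X \<in> \<Omega> n" and "p \<in> GL n" "p = (s, t)"
  hence GL: "(s, t) \<in> GL n" by simp
  note car = respects_intertwiners_carrier[OF int]
  note [simp] = X[THEN square] X[THEN car]
  have [simp]: "s \<in> carrier_mat n n" "t \<in> carrier_mat n n" and st: "s * t = 1\<^sub>m n" "t * s = 1\<^sub>m n"
    using GL by (auto simp: GL_def)
  define W where "W = scalar_mat s * X * scalar_mat t"
  have W: "W \<in> \<Omega> n" unfolding W_def by (rule similar[OF X GL])
  note [simp] = W[THEN car] W[THEN car, THEN carrier_matD(1)] W[THEN car, THEN carrier_matD(2)]
  have "W * scalar_mat s = scalar_mat s * X * (scalar_mat t * scalar_mat s)"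
    unfolding W_def by (rule assoc_mult_mat[of _ n n _ n _ n]) (auto intro!: mult_carrier_mat[of _ n n _ n])
  also have "scalar_mat t * scalar_mat s = (1\<^sub>m n :: 'a mat)"
    using scalar_mat_mult[of t n n s n, symmetric] st by simp
  also have "scalar_mat s * X * 1\<^sub>m n = scalar_mat s * X"
    by (rule right_mult_one_mat[of _ n]) (auto intro!: mult_carrier_mat[of _ n n _ n])
  finally have "\<phi> n W * s = s * \<phi> n X"
    by (intro respects_intertwinersD[OF int W X]) auto
  hence "s * \<phi> n X * t = \<phi> n W * (s * t)"
    using assoc_mult_mat[of "\<phi> n W" n n s n t n] by simp
  thus "\<phi> n (scalar_mat s * X * scalar_mat t) = s * \<phi> n X * t"
    using st by (simp add: W_def[symmetric])
qed

section \<open>Difference quotients in scalar directions\<close>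

text \<open>The upper right block of the value of \<open>\<phi>\<close> at the triangular matrix with diagonal blocks
  \<open>X\<close>, \<open>Y\<close> and corner \<open>\<gamma> \<otimes> 1\<close>. It plays the role of a difference quotient of \<open>\<phi>\<close> in the
  direction \<open>\<gamma>\<close>.\<close>

definition corner ::
  "(nat \<Rightarrow> 'a mat \<Rightarrow> complex mat) \<Rightarrow> nat \<Rightarrow> nat \<Rightarrow> 'a mat \<Rightarrow> 'a mat \<Rightarrow> complex mat \<Rightarrow> complex mat"
  where
  "corner \<phi> n m X Y \<gamma> =
     mat n m (\<lambda>(a, d). \<phi> (n + m) (upper_block X (scalar_mat \<gamma>) Y) $$ (a, n + d))"

lemma corner_carrier [simp]: "corner \<phi> n m X Y \<gamma> \<in> carrier_mat n m"
  by (simp add: corner_def)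

lemma corner_dim [simp]:
  "dim_row (corner \<phi> n m X Y \<gamma>) = n" "dim_col (corner \<phi> n m X Y \<gamma>) = m"
  by (simp_all add: corner_def)

text \<open>The other three blocks are found by comparing the triangular matrix with \<open>X \<oplus> Y\<close>: the
  projections \<open>P\<close> and \<open>Q\<close> onto the two blocks intertwine them, in opposite directions.\<close>

lemma nc_upper_block:
  assumes int: "respects_intertwiners \<phi>"
    and X: "X \<in> \<Omega> n" and Y: "Y \<in> \<Omega> m" and \<gamma> [simp]: "\<gamma> \<in> carrier_mat n m"
  shows "\<phi> (n + m) (upper_block X (scalar_mat \<gamma>) Y) =
    four_block_mat (\<phi> n X) (corner \<phi> n m X Y \<gamma>) (0\<^sub>m m n) (\<phi> m Y)"
proof -
  note car = respects_intertwiners_carrier[OF int]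
  define U where "U = upper_block X (scalar_mat \<gamma>) Y"
  have U: "U \<in> \<Omega> (n + m)" unfolding U_def by (rule upper_block_mem[OF X Y \<gamma>])
  have D: "dsum X Y \<in> \<Omega> (n + m)" by (rule dsum_mem[OF X Y])
  note [simp] = X[THEN square] Y[THEN square] X[THEN car] Y[THEN car] \<gamma>
  note [simp] = this[THEN carrier_matD(1)] this[THEN carrier_matD(2)]
  obtain A B C E where ABCE: "split_block (\<phi> (n + m) U) n n = (A, B, C, E)"
    by (cases "split_block (\<phi> (n + m) U) n n") auto
  have [simp]: "A \<in> carrier_mat n n" "B \<in> carrier_mat n m" "C \<in> carrier_mat m n" "E \<in> carrier_mat m m"
    and \<phi>U: "\<phi> (n + m) U = four_block_mat A B C E"
    using split_block[OF ABCE] car[OF U] by auto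
  note [simp] = this(1-4)[THEN carrier_matD(1)] this(1-4)[THEN carrier_matD(2)]
  have Ub: "U = four_block_mat X (scalar_mat \<gamma>) (0\<^sub>m m n) Y"
    unfolding U_def by (rule upper_block_four_block) auto
  have Db: "dsum X Y = four_block_mat X (0\<^sub>m n m) (0\<^sub>m m n) Y"
    by (rule dsum_four_block(1)) auto
  have "\<phi> (n + m) (dsum X Y) = dsum (\<phi> n X) (\<phi> m Y)"
    using nc_funD(1)[OF respects_intertwiners_nc_fun[OF int] X Y] by simp
  hence \<phi>D: "\<phi> (n + m) (dsum X Y) = four_block_mat (\<phi> n X) (0\<^sub>m n m) (0\<^sub>m m n) (\<phi> m Y)"
    by (simp add: dsum_four_block(1)[of _ n _ m])
  define P where "P = four_block_mat (1\<^sub>m n) (0\<^sub>m n m) (0\<^sub>m m n) (0\<^sub>m m m :: complex mat)"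
  define Q where "Q = four_block_mat (0\<^sub>m n n) (0\<^sub>m n m) (0\<^sub>m m n) (1\<^sub>m m :: complex mat)"
  have PQ: "P \<in> carrier_mat (n + m) (n + m)" "Q \<in> carrier_mat (n + m) (n + m)"
    by (auto simp: P_def Q_def)
  have sP: "scalar_mat P = four_block_mat (1\<^sub>m n) (0\<^sub>m n m) (0\<^sub>m m n) (0\<^sub>m m m)"
    unfolding P_def by (subst scalar_mat_four_block[of _ n n _ m _ m]) auto
  have sQ: "scalar_mat Q = four_block_mat (0\<^sub>m n n) (0\<^sub>m n m) (0\<^sub>m m n) (1\<^sub>m m)"
    unfolding Q_def by (subst scalar_mat_four_block[of _ n n _ m _ m]) auto
  have "U * scalar_mat P = scalar_mat P * dsum X Y"
    unfolding Ub Db sP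
    by (subst (1 2) upper_triangular_mult[of _ n n _ m _ m _ n _ m]) auto
  hence "\<phi> (n + m) U * P = P * \<phi> (n + m) (dsum X Y)"
    using PQ by (intro respects_intertwinersD[OF int U D]) auto
  moreover have "\<phi> (n + m) U * P = four_block_mat A (0\<^sub>m n m) C (0\<^sub>m m m)"
    unfolding \<phi>U P_def by (subst mult_four_block_mat[of _ n n _ m _ m _ _ n _ m]) auto
  moreover have "P * \<phi> (n + m) (dsum X Y) = four_block_mat (\<phi> n X) (0\<^sub>m n m) (0\<^sub>m m n) (0\<^sub>m m m)"
    unfolding \<phi>D P_def by (subst upper_triangular_mult[of _ n n _ m _ m _ n _ m]) auto
  ultimately have 1: "A = \<phi> n X \<and> C = 0\<^sub>m m n"
    using four_block_mat_eq_iff[of A n n "0\<^sub>m n m" m C m "0\<^sub>m m m" "\<phi> n X" "0\<^sub>m n m" "0\<^sub>m m n" "0\<^sub>m m m"]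
    by auto
  have "dsum X Y * scalar_mat Q = scalar_mat Q * U"
    unfolding Ub Db sQ
    by (subst (1 2) upper_triangular_mult[of _ n n _ m _ m _ n _ m]) auto
  hence "\<phi> (n + m) (dsum X Y) * Q = Q * \<phi> (n + m) U"
    using PQ by (intro respects_intertwinersD[OF int D U]) auto
  moreover have "Q * \<phi> (n + m) U = four_block_mat (0\<^sub>m n n) (0\<^sub>m n m) C E"
    unfolding \<phi>U Q_def by (subst mult_four_block_mat[of _ n n _ m _ m _ _ n _ m]) auto
  moreover have "\<phi> (n + m) (dsum X Y) * Q = four_block_mat (0\<^sub>m n n) (0\<^sub>m n m) (0\<^sub>m m n) (\<phi> m Y)"
    unfolding \<phi>D Q_def by (subst upper_triangular_mult[of _ n n _ m _ m _ n _ m]) auto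
  ultimately have 2: "E = \<phi> m Y"
    using four_block_mat_eq_iff[of "0\<^sub>m n n" n n "0\<^sub>m n m" m C m E "0\<^sub>m n n" "0\<^sub>m n m" "0\<^sub>m m n" "\<phi> m Y"]
    by auto
  have "B = corner \<phi> n m X Y \<gamma>"
    by (rule eq_matI) (auto simp: corner_def U_def[symmetric] \<phi>U)
  with 1 2 \<phi>U show ?thesis by (simp add: U_def)
qed

text \<open>The source of linearity and of the compatibility conditions: \<open>S \<oplus> T\<close> intertwines the two
  triangular matrices, and the corner of the resulting relation is the claim.\<close>

lemma corner_intertwines:
  assumes int: "respects_intertwiners \<phi>"
    and X: "X \<in> \<Omega> n" and X': "X' \<in> \<Omega> n'" and Y: "Y \<in> \<Omega> m" and Y': "Y' \<in> \<Omega> m'"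
    and S: "S \<in> carrier_mat n n'" and T: "T \<in> carrier_mat m m'"
    and \<gamma>: "\<gamma> \<in> carrier_mat n m" and \<gamma>': "\<gamma>' \<in> carrier_mat n' m'"
    and XS: "X * scalar_mat S = scalar_mat S * X'" and YT: "Y * scalar_mat T = scalar_mat T * Y'"
    and S\<gamma>: "S * \<gamma>' = \<gamma> * T"
  shows "corner \<phi> n m X Y \<gamma> * T = S * corner \<phi> n' m' X' Y' \<gamma>'"
proof -
  note car = respects_intertwiners_carrier[OF int]
  note [simp] = X[THEN square] Y[THEN square] X'[THEN square] Y'[THEN square]
    X[THEN car] Y[THEN car] X'[THEN car] Y'[THEN car] \<gamma> \<gamma>' S T
  note [simp] = this[THEN carrier_matD(1)] this[THEN carrier_matD(2)]
  define U where "U = upper_block X (scalar_mat \<gamma>) Y"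
  define U' where "U' = upper_block X' (scalar_mat \<gamma>') Y'"
  have U: "U \<in> \<Omega> (n + m)" unfolding U_def by (rule upper_block_mem[OF X Y \<gamma>])
  have U': "U' \<in> \<Omega> (n' + m')" unfolding U'_def by (rule upper_block_mem[OF X' Y' \<gamma>'])
  have Ub: "U = four_block_mat X (scalar_mat \<gamma>) (0\<^sub>m m n) Y"
    unfolding U_def by (rule upper_block_four_block) auto
  have U'b: "U' = four_block_mat X' (scalar_mat \<gamma>') (0\<^sub>m m' n') Y'"
    unfolding U'_def by (rule upper_block_four_block) auto
  define R where "R = four_block_mat S (0\<^sub>m n m') (0\<^sub>m m n') T"
  have R: "R \<in> carrier_mat (n + m) (n' + m')" by (auto simp: R_def)
  have sR: "scalar_mat R = four_block_mat (scalar_mat S) (0\<^sub>m n m') (0\<^sub>m m n') (scalar_mat T)"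
    unfolding R_def by (subst scalar_mat_four_block[of _ n n' _ m' _ m]) auto
  have sS\<gamma>: "scalar_mat S * scalar_mat \<gamma>' = scalar_mat \<gamma> * scalar_mat T"
    using S\<gamma> by (simp add: scalar_mat_mult[OF S \<gamma>', symmetric] scalar_mat_mult[OF \<gamma> T, symmetric])
  have "U * scalar_mat R =
      four_block_mat (X * scalar_mat S) (scalar_mat \<gamma> * scalar_mat T) (0\<^sub>m m n') (Y * scalar_mat T)"
    unfolding Ub sR by (subst upper_triangular_mult[of _ n n _ m _ m _ n' _ m']) auto
  moreover have "scalar_mat R * U' =
      four_block_mat (scalar_mat S * X') (scalar_mat S * scalar_mat \<gamma>') (0\<^sub>m m n') (scalar_mat T * Y')"
    unfolding U'b sR by (subst upper_triangular_mult[of _ n n' _ m' _ m _ n' _ m']) auto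
  ultimately have "U * scalar_mat R = scalar_mat R * U'"
    by (simp add: XS YT sS\<gamma>)
  hence "\<phi> (n + m) U * R = R * \<phi> (n' + m') U'"
    by (intro respects_intertwinersD[OF int U U' R])
  moreover have "\<phi> (n + m) U * R = four_block_mat (\<phi> n X * S) (corner \<phi> n m X Y \<gamma> * T)
      (0\<^sub>m m n') (\<phi> m Y * T)"
    unfolding U_def nc_upper_block[OF int X Y \<gamma>] R_def
    by (subst upper_triangular_mult[of _ n n _ m _ m _ n' _ m']) auto
  moreover have "R * \<phi> (n' + m') U' = four_block_mat (S * \<phi> n' X') (S * corner \<phi> n' m' X' Y' \<gamma>')
      (0\<^sub>m m n') (T * \<phi> m' Y')"
    unfolding U'_def nc_upper_block[OF int X' Y' \<gamma>'] R_def
    by (subst upper_triangular_mult[of _ n n' _ m' _ m _ n' _ m']) auto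
  ultimately show ?thesis
    using four_block_mat_eq_iff[of "\<phi> n X * S" n n' "corner \<phi> n m X Y \<gamma> * T" m' "0\<^sub>m m n'" m "\<phi> m Y * T"
        "S * \<phi> n' X'" "S * corner \<phi> n' m' X' Y' \<gamma>'" "0\<^sub>m m n'" "T * \<phi> m' Y'"]
      mult_carrier_mat[OF X[THEN car] S] mult_carrier_mat[OF corner_carrier T]
      mult_carrier_mat[OF Y[THEN car] T] mult_carrier_mat[OF S X'[THEN car]]
      mult_carrier_mat[OF S corner_carrier] mult_carrier_mat[OF T Y'[THEN car]]
    by auto
qed

lemma corner_mult_right:
  assumes int: "respects_intertwiners \<phi>"
    and X: "X \<in> \<Omega> n" and Y: "Y \<in> \<Omega> m" and Y': "Y' \<in> \<Omega> m'"
    and T: "T \<in> carrier_mat m m'" and \<gamma>: "\<gamma> \<in> carrier_mat n m"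
    and YT: "Y * scalar_mat T = scalar_mat T * Y'"
  shows "corner \<phi> n m X Y \<gamma> * T = corner \<phi> n m' X Y' (\<gamma> * T)"
  using corner_intertwines[OF int X X Y Y' one_carrier_mat T \<gamma> mult_carrier_mat[OF \<gamma> T] _ YT]
    square[OF X] by (simp add: carrier_matD[OF square[OF X]] carrier_matD[OF \<gamma>])

lemma corner_mult_left:
  assumes int: "respects_intertwiners \<phi>"
    and X: "X \<in> \<Omega> n" and X': "X' \<in> \<Omega> n'" and Y: "Y \<in> \<Omega> m"
    and S: "S \<in> carrier_mat n n'" and \<gamma>: "\<gamma> \<in> carrier_mat n' m"
    and XS: "X * scalar_mat S = scalar_mat S * X'"
  shows "S * corner \<phi> n' m X' Y \<gamma> = corner \<phi> n m X Y (S * \<gamma>)"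
  using corner_intertwines[OF int X X' Y Y S one_carrier_mat mult_carrier_mat[OF S \<gamma>] \<gamma> XS]
    square[OF Y] by (simp add: carrier_matD[OF square[OF Y]] carrier_matD[OF \<gamma>])

text \<open>The three corners are \<open>K T\<close> for a single \<open>K\<close>, the corner at \<open>X\<close> and \<open>Y \<oplus> Y\<close> in the
  direction \<open>[\<gamma>1 \<gamma>2]\<close>, where \<open>T\<close> is one of the columns with blocks \<open>(1, 1)\<close>, \<open>(1, 0)\<close>, \<open>(0, 1)\<close>,
  each of which intertwines \<open>Y \<oplus> Y\<close> with \<open>Y\<close>.\<close>

lemma corner_add:
  assumes int: "respects_intertwiners \<phi>" and X: "X \<in> \<Omega> n" and Y: "Y \<in> \<Omega> m"
    and \<gamma>1: "\<gamma>1 \<in> carrier_mat n m" and \<gamma>2: "\<gamma>2 \<in> carrier_mat n m"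
  shows "corner \<phi> n m X Y (\<gamma>1 + \<gamma>2) = corner \<phi> n m X Y \<gamma>1 + corner \<phi> n m X Y \<gamma>2"
proof -
  note [simp] = \<gamma>1 \<gamma>2 Y[THEN square]
  note [simp] = this[THEN carrier_matD(1)] this[THEN carrier_matD(2)]
  have D: "dsum Y Y \<in> \<Omega> (m + m)" by (rule dsum_mem[OF Y Y])
  have Db: "dsum Y Y = four_block_mat Y (0\<^sub>m m m) (0\<^sub>m m m) Y" by (rule dsum_four_block(1)) auto
  define K where "K = corner \<phi> n (m + m) X (dsum Y Y) (\<gamma>1 @\<^sub>h \<gamma>2)"
  have K: "K \<in> carrier_mat n (m + m)" by (simp add: K_def)
  have step: "K * (A @\<^sub>r B) = corner \<phi> n m X Y (\<gamma>1 * A + \<gamma>2 * B)"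
    if "A \<in> {0\<^sub>m m m, 1\<^sub>m m}" "B \<in> {0\<^sub>m m m, 1\<^sub>m m}" for A B :: "complex mat"
  proof -
    have AB: "A \<in> carrier_mat m m" "B \<in> carrier_mat m m" using that by auto
    have sAB: "scalar_mat (A @\<^sub>r B) = scalar_mat A @\<^sub>r scalar_mat B"
      by (rule scalar_mat_append_rows[OF AB])
    have "dsum Y Y * scalar_mat (A @\<^sub>r B) = scalar_mat (A @\<^sub>r B) * Y"
      unfolding Db sAB using that
      by (subst four_block_mult_append_rows[of _ m m _ m _ m _ _ m], insert AB, simp_all,
          subst append_rows_mult[of _ m m _ m _ m], auto)
    hence "K * (A @\<^sub>r B) = corner \<phi> n m X Y ((\<gamma>1 @\<^sub>h \<gamma>2) * (A @\<^sub>r B))"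
      unfolding K_def using AB by (intro corner_mult_right[OF int X D Y]) auto
    also have "(\<gamma>1 @\<^sub>h \<gamma>2) * (A @\<^sub>r B) = \<gamma>1 * A + \<gamma>2 * B"
      using AB by (intro append_cols_mult_append_rows[of _ n m _ m _ m]) auto
    finally show ?thesis .
  qed
  have "(1\<^sub>m m @\<^sub>r 1\<^sub>m m :: complex mat) = (1\<^sub>m m @\<^sub>r 0\<^sub>m m m) + (0\<^sub>m m m @\<^sub>r 1\<^sub>m m)"
    by (rule eq_matI) (auto simp: append_rows_def)
  hence "K * (1\<^sub>m m @\<^sub>r 1\<^sub>m m) = K * (1\<^sub>m m @\<^sub>r 0\<^sub>m m m) + K * (0\<^sub>m m m @\<^sub>r 1\<^sub>m m)"
    using K by (simp add: mult_add_distrib_mat[of _ n "m + m" _ m])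
  thus ?thesis by (simp add: step)
qed

lemma corner_smult:
  assumes int: "respects_intertwiners \<phi>" and X: "X \<in> \<Omega> n" and Y: "Y \<in> \<Omega> m"
    and \<gamma>: "\<gamma> \<in> carrier_mat n m"
  shows "corner \<phi> n m X Y (c \<cdot>\<^sub>m \<gamma>) = c \<cdot>\<^sub>m corner \<phi> n m X Y \<gamma>"
proof -
  have "corner \<phi> n m X Y \<gamma> * (c \<cdot>\<^sub>m 1\<^sub>m m) = corner \<phi> n m X Y (\<gamma> * (c \<cdot>\<^sub>m 1\<^sub>m m))"
    using scalar_mat_smult_one_commute[OF square[OF Y]]
    by (intro corner_mult_right[OF int X Y Y _ \<gamma>]) auto
  thus ?thesis
    by (simp add: mult_smult_distrib[OF \<gamma> one_carrier_mat] carrier_matD[OF \<gamma>]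
        mult_smult_distrib[OF corner_carrier one_carrier_mat])
qed

lemma corner_matrix_units:
  assumes int: "respects_intertwiners \<phi>" and X: "X \<in> \<Omega> n" and Y: "Y \<in> \<Omega> m"
    and \<gamma>: "\<gamma> \<in> carrier_mat n m" and ad: "a < n" "d < m"
  shows "corner \<phi> n m X Y \<gamma> $$ (a, d) =
    (\<Sum>b<n. \<Sum>c<m. \<gamma> $$ (b, c) * corner \<phi> n m X Y (matrix_unit n m b c) $$ (a, d))"
  by (rule linear_functional_matrix_units[OF _ _ \<gamma>])
    (use ad in \<open>auto simp: corner_add[OF int X Y] corner_smult[OF int X Y]\<close>)

text \<open>The coefficients of the corner at the matrix units \<open>e\<^sub>b\<^sub>c\<close>, for fixed \<open>c\<close> and fixed column \<open>d\<close>,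
  form a noncommutative function of \<open>X\<close>: a matrix \<open>S\<close> acting on the direction \<open>e\<^sub>j\<^sub>c\<close> produces the
  combination of the \<open>e\<^sub>b\<^sub>c\<close> with coefficients \<open>S\<^sub>b\<^sub>j\<close>, and linearity turns this into
  multiplication by \<open>S\<close> on the right.\<close>

lemma respects_intertwiners_corner_left:
  assumes int: "respects_intertwiners \<phi>" and Y: "Y \<in> \<Omega> m" and cd: "c < m" "d < m"
  shows "respects_intertwiners
    (\<lambda>n X. mat n n (\<lambda>(a, b). corner \<phi> n m X Y (matrix_unit n m b c) $$ (a, d)))"
  unfolding respects_intertwiners_def
proof (intro conjI allI ballI impI)
  fix n n' X X' and S :: "complex mat"
  assume X: "X \<in> \<Omega> n" and X': "X' \<in> \<Omega> n'" and S: "S \<in> carrier_mat n n'"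
    and XS: "X * scalar_mat S = scalar_mat S * X'"
  let ?M = "\<lambda>n X. mat n n (\<lambda>(a, b). corner \<phi> n m X Y (matrix_unit n m b c) $$ (a, d))"
  show "?M n X * S = S * ?M n' X'"
  proof (rule eq_matI)
    fix i j assume "i < dim_row (S * ?M n' X')" "j < dim_col (S * ?M n' X')"
    hence ij: "i < n" "j < n'" using S by auto
    have "(S * ?M n' X') $$ (i, j) = (S * corner \<phi> n' m X' Y (matrix_unit n' m j c)) $$ (i, d)"
      using S ij cd by (auto simp: scalar_prod_def intro!: sum.cong)
    also have "\<dots> = corner \<phi> n m X Y (S * matrix_unit n' m j c) $$ (i, d)"
      by (simp add: corner_mult_left[OF int X X' Y S _ XS])
    also have "S * matrix_unit n' m j c = mat n m (\<lambda>(b, e). if e = c then S $$ (b, j) else 0)"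
      using S ij by (intro eq_matI) (auto simp: scalar_prod_def mult_delta_left mult_delta_right)
    also have "corner \<phi> n m X Y \<dots> $$ (i, d) =
        (\<Sum>b<n. \<Sum>e<m. (if e = c then S $$ (b, j) * corner \<phi> n m X Y (matrix_unit n m b e) $$ (i, d) else 0))"
      using ij cd by (subst corner_matrix_units[OF int X Y]) (simp_all add: mult_delta_left)
    also have "\<dots> = (\<Sum>b<n. S $$ (b, j) * corner \<phi> n m X Y (matrix_unit n m b c) $$ (i, d))"
      using cd by simp
    also have "\<dots> = (?M n X * S) $$ (i, j)"
      using S ij by (auto simp: scalar_prod_def atLeast0LessThan intro!: sum.cong)
    finally show "(?M n X * S) $$ (i, j) = (S * ?M n' X') $$ (i, j)" by simp
  qed (use S in auto)
qed auto

lemma respects_intertwiners_corner_right: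
  assumes int: "respects_intertwiners \<phi>" and X: "X \<in> \<Omega> n" and ab: "a < n" "b < n"
  shows "respects_intertwiners
    (\<lambda>m Y. mat m m (\<lambda>(c, d). corner \<phi> n m X Y (matrix_unit n m b c) $$ (a, d)))"
  unfolding respects_intertwiners_def
proof (intro conjI allI ballI impI)
  fix m m' Y Y' and T :: "complex mat"
  assume Y: "Y \<in> \<Omega> m" and Y': "Y' \<in> \<Omega> m'" and T: "T \<in> carrier_mat m m'"
    and YT: "Y * scalar_mat T = scalar_mat T * Y'"
  let ?M = "\<lambda>m Y. mat m m (\<lambda>(c, d). corner \<phi> n m X Y (matrix_unit n m b c) $$ (a, d))"
  show "?M m Y * T = T * ?M m' Y'"
  proof (rule eq_matI)
    fix i j assume "i < dim_row (T * ?M m' Y')" "j < dim_col (T * ?M m' Y')"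
    hence ij: "i < m" "j < m'" using T by auto
    have "(?M m Y * T) $$ (i, j) = (corner \<phi> n m X Y (matrix_unit n m b i) * T) $$ (a, j)"
      using T ij ab by (auto simp: scalar_prod_def intro!: sum.cong)
    also have "\<dots> = corner \<phi> n m' X Y' (matrix_unit n m b i * T) $$ (a, j)"
      by (simp add: corner_mult_right[OF int X Y Y' T _ YT])
    also have "matrix_unit n m b i * T = mat n m' (\<lambda>(e, c). if e = b then T $$ (i, c) else 0)"
      using T ij by (intro eq_matI) (auto simp: scalar_prod_def mult_delta_left mult_delta_right)
    also have "corner \<phi> n m' X Y' \<dots> $$ (a, j) =
        (\<Sum>e<n. \<Sum>c<m'. (if e = b then T $$ (i, c) * corner \<phi> n m' X Y' (matrix_unit n m' e c) $$ (a, j) else 0))"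
      using ij ab by (subst corner_matrix_units[OF int X Y']) (simp_all add: mult_delta_left)
    also have "\<dots> = (\<Sum>c<m'. \<Sum>e<n. (if e = b then T $$ (i, c) * corner \<phi> n m' X Y' (matrix_unit n m' e c) $$ (a, j) else 0))"
      by (rule sum.swap)
    also have "\<dots> = (\<Sum>c<m'. T $$ (i, c) * corner \<phi> n m' X Y' (matrix_unit n m' b c) $$ (a, j))"
      using ab by simp
    also have "\<dots> = (T * ?M m' Y') $$ (i, j)"
      using T ij by (auto simp: scalar_prod_def atLeast0LessThan intro!: sum.cong)
    finally show "(?M m Y * T) $$ (i, j) = (T * ?M m' Y') $$ (i, j)" .
  qed (use T in auto)
qed auto

section \<open>The partial derivatives as difference quotients\<close>

lemma nc_fun_cong:
  assumes "nc_fun \<Omega> \<psi>" and "\<And>n X. X \<in> \<Omega> n \<Longrightarrow> \<phi> n X = \<psi> n X"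
  shows "nc_fun \<Omega> \<phi>"
  unfolding nc_fun_def
proof (intro conjI allI ballI case_prodI2)
  fix m n X Y assume "X \<in> \<Omega> m" "Y \<in> \<Omega> n"
  thus "\<phi> (m + n) (dsum X Y) = dsum (\<phi> m X) (\<phi> n Y)"
    using nc_funD(1)[OF assms(1)] by (simp add: assms(2) dsum_mem)
next
  fix n X p s t assume "X \<in> \<Omega> n" "p \<in> GL n" "p = (s, t)"
  thus "\<phi> n (scalar_mat s * X * scalar_mat t) = s * \<phi> n X * t"
    using nc_funD(2)[OF assms(1)] by (simp add: assms(2) similar)
qed

lemma respects_intertwiners_slice1:
  assumes "f \<in> nc2 \<Omega>" "Y \<in> \<Omega> m" "v \<in> idx m"
  shows "respects_intertwiners (slice1 f m Y v)"
proof (rule nc_fun_respects_intertwiners)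
  show "nc_fun \<Omega> (slice1 f m Y v)" using assms by (simp add: nc2_def slice1_def)
qed (simp add: slice1_def)

lemma corner_slice1:
  assumes "a < n" "d < n'"
  shows "corner (slice1 f l Y v) n n' X X' \<gamma> $$ (a, d) =
    f (n + n') l (upper_block X (scalar_mat \<gamma>) X') Y (a, n + d) v"
  using assms by (simp add: corner_def slice1_def)

text \<open>The function differentiated in \<open>\<partial> \<otimes> id\<close> is \<open>z\<close> times the corner in the direction of a matrix
  unit, so its derivative at \<open>0\<close> is that corner.\<close>

lemma partial_id_corner:
  assumes f: "f \<in> nc2 \<Omega>" and X: "X \<in> \<Omega> n" and X': "X' \<in> \<Omega> n'" and Y: "Y \<in> \<Omega> l"
    and idx: "(a, b) \<in> idx n" "(c, d) \<in> idx n'" "v \<in> idx l"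
  shows "partial_id f n n' l X X' Y (a, b) (c, d) v =
    corner (slice1 f l Y v) n n' X X' (matrix_unit n n' b c) $$ (a, d)" (is "_ = ?k")
proof -
  have ad: "a < n" "d < n'" using idx by (auto simp: idx_def)
  note int = respects_intertwiners_slice1[OF f Y idx(3)]
  have "(\<lambda>z. f (n + n') l (upper_block X (scalar_mat (z \<cdot>\<^sub>m matrix_unit n n' b c)) X') Y (a, n + d) v) =
      (\<lambda>z. z * ?k)"
    using ad by (simp add: corner_slice1[symmetric] corner_smult[OF int X X'])
  moreover have "deriv (\<lambda>z. z * ?k) 0 = ?k"
    by (rule DERIV_imp_deriv) (auto intro!: derivative_eq_intros)
  ultimately show ?thesis using idx by (cases v) (simp add: partial_id_def)
qed

lemma partial_id_tens3: "partial_id f n n' l X X' Y \<in> tens3 n n' l"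
  by (auto simp: tens3_def partial_id_def split: if_splits)

lemma partial_id_nc3:
  assumes f: "f \<in> nc2 \<Omega>"
  shows "partial_id f \<in> nc3 \<Omega>"
  unfolding nc3_def
proof (intro CollectI conjI allI ballI)
  show "partial_id f n1 n2 n3 X1 X2 X3 \<in> tens3 n1 n2 n3" for n1 n2 n3 X1 X2 X3
    by (rule partial_id_tens3)
next
  fix n2 n3 X2 X3 v w
  assume X2: "X2 \<in> \<Omega> n2" and X3: "X3 \<in> \<Omega> n3" and v: "v \<in> idx n2" and w: "w \<in> idx n3"
  obtain c d where cd: "v = (c, d)" "c < n2" "d < n2" using v by (auto simp: idx_def)
  show "nc_fun \<Omega> (\<lambda>n1 X1. mat n1 n1 (\<lambda>u. partial_id f n1 n2 n3 X1 X2 X3 u v w))"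
    by (rule nc_fun_cong[OF respects_intertwiners_nc_fun[OF
          respects_intertwiners_corner_left[OF respects_intertwiners_slice1[OF f X3 w] X2 cd(2,3)]]])
      (use v in \<open>auto intro!: eq_matI simp: partial_id_corner[OF f _ X2 X3 _ _ w] cd(1) idx_def\<close>)
next
  fix n1 n3 X1 X3 u w
  assume X1: "X1 \<in> \<Omega> n1" and X3: "X3 \<in> \<Omega> n3" and u: "u \<in> idx n1" and w: "w \<in> idx n3"
  obtain a b where ab: "u = (a, b)" "a < n1" "b < n1" using u by (auto simp: idx_def)
  show "nc_fun \<Omega> (\<lambda>n2 X2. mat n2 n2 (\<lambda>v. partial_id f n1 n2 n3 X1 X2 X3 u v w))"
    by (rule nc_fun_cong[OF respects_intertwiners_nc_fun[OF
          respects_intertwiners_corner_right[OF respects_intertwiners_slice1[OF f X3 w] X1 ab(2,3)]]])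
      (use u in \<open>auto intro!: eq_matI simp: partial_id_corner[OF f X1 _ X3 _ _ w] ab(1) idx_def\<close>)
next
  fix n1 n2 X1 X2 u v
  assume X1: "X1 \<in> \<Omega> n1" and X2: "X2 \<in> \<Omega> n2" and u: "u \<in> idx n1" and v: "v \<in> idx n2"
  obtain a b where ab: "u = (a, b)" "a < n1" "b < n1" using u by (auto simp: idx_def)
  obtain c d where cd: "v = (c, d)" "c < n2" "d < n2" using v by (auto simp: idx_def)
  define U where "U = upper_block X1 (scalar_mat (matrix_unit n1 n2 b c)) X2"
  have U: "U \<in> \<Omega> (n1 + n2)" unfolding U_def by (rule upper_block_mem[OF X1 X2]) simp
  have "(a, n1 + d) \<in> idx (n1 + n2)" using ab cd by (simp add: idx_def)
  hence nc: "nc_fun \<Omega> (\<lambda>n3 X3. mat n3 n3 (\<lambda>w. f (n1 + n2) n3 U X3 (a, n1 + d) w))"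
    using f U by (simp add: nc2_def)
  show "nc_fun \<Omega> (\<lambda>n3 X3. mat n3 n3 (\<lambda>w. partial_id f n1 n2 n3 X1 X2 X3 u v w))"
  proof (rule nc_fun_cong[OF nc])
    fix n3 X3 assume X3: "X3 \<in> \<Omega> n3"
    have "partial_id f n1 n2 n3 X1 X2 X3 u v w = f (n1 + n2) n3 U X3 (a, n1 + d) w" if "w \<in> idx n3" for w
      using u v that ab cd by (simp add: partial_id_corner[OF f X1 X2 X3] corner_slice1 U_def)
    thus "mat n3 n3 (\<lambda>w. partial_id f n1 n2 n3 X1 X2 X3 u v w) =
        mat n3 n3 (\<lambda>w. f (n1 + n2) n3 U X3 (a, n1 + d) w)"
      by (intro eq_matI) (auto simp: idx_def)
  qed
qed

lemma id_partial_nc3: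
  assumes f: "f \<in> nc2 \<Omega>"
  shows "id_partial f \<in> nc3 \<Omega>"
proof -
  have "id_partial f = (\<lambda>l n n' Y X X' u v w. partial_id (swap2 f) n n' l X X' Y v w u)"
    by (intro ext) (rule id_partial_swap2)
  thus ?thesis using nc3_rotate[OF partial_id_nc3[OF swap2_nc2[OF f]]] by simp
qed

text \<open>The coefficients of a family at an upper triangular first argument, and likewise at an upper
  triangular second argument.\<close>

lemma nc2_upper_block_first:
  assumes f: "f \<in> nc2 \<Omega>" and X: "X \<in> \<Omega> n" and X': "X' \<in> \<Omega> n'" and Y: "Y \<in> \<Omega> m" and v: "v \<in> idx m"
    and \<gamma>: "\<gamma> \<in> carrier_mat n n'"
  defines "U \<equiv> upper_block X (scalar_mat \<gamma>) X'"
  shows "i < n \<Longrightarrow> j < n \<Longrightarrow> f (n + n') m U Y (i, j) v = f n m X Y (i, j) v"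
    and "i < n' \<Longrightarrow> j < n \<Longrightarrow> f (n + n') m U Y (n + i, j) v = 0"
    and "i < n' \<Longrightarrow> j < n' \<Longrightarrow> f (n + n') m U Y (n + i, n + j) v = f n' m X' Y (i, j) v"
    and "i < n \<Longrightarrow> j < n' \<Longrightarrow> f (n + n') m U Y (i, n + j) v =
      (\<Sum>b<n. \<Sum>c<n'. \<gamma> $$ (b, c) * partial_id f n n' m X X' Y (i, b) (c, j) v)"
proof -
  note int = respects_intertwiners_slice1[OF f Y v]
  have block: "slice1 f m Y v (n + n') U = four_block_mat (slice1 f m Y v n X)
      (corner (slice1 f m Y v) n n' X X' \<gamma>) (0\<^sub>m n' n) (slice1 f m Y v n' X')"
    unfolding U_def by (rule nc_upper_block[OF int X X' \<gamma>])
  have entry: "f (n + n') m U Y (i, j) v = slice1 f m Y v (n + n') U $$ (i, j)"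
    if "i < n + n'" "j < n + n'" for i j
    using that by (simp add: slice1_def)
  have dims: "dim_row (slice1 f m Y v n X) = n" "dim_col (slice1 f m Y v n X) = n" for n X
    by (simp_all add: slice1_def)
  show "f (n + n') m U Y (i, j) v = f n m X Y (i, j) v" if "i < n" "j < n"
    using that by (simp add: entry block dims) (simp add: slice1_def)
  show "f (n + n') m U Y (n + i, j) v = 0" if "i < n'" "j < n"
    using that by (simp add: entry block dims)
  show "f (n + n') m U Y (n + i, n + j) v = f n' m X' Y (i, j) v" if "i < n'" "j < n'"
    using that by (simp add: entry block dims) (simp add: slice1_def)
  show "f (n + n') m U Y (i, n + j) v =
      (\<Sum>b<n. \<Sum>c<n'. \<gamma> $$ (b, c) * partial_id f n n' m X X' Y (i, b) (c, j) v)" if "i < n" "j < n'"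
  proof -
    have "f (n + n') m U Y (i, n + j) v = corner (slice1 f m Y v) n n' X X' \<gamma> $$ (i, j)"
      using that by (simp add: corner_slice1 U_def)
    also have "\<dots> = (\<Sum>b<n. \<Sum>c<n'. \<gamma> $$ (b, c) *
        corner (slice1 f m Y v) n n' X X' (matrix_unit n n' b c) $$ (i, j))"
      by (rule corner_matrix_units[OF int X X' \<gamma> that])
    also have "\<dots> = (\<Sum>b<n. \<Sum>c<n'. \<gamma> $$ (b, c) * partial_id f n n' m X X' Y (i, b) (c, j) v)"
      using that v by (intro sum.cong refl) (simp add: partial_id_corner[OF f X X' Y] idx_def)
    finally show ?thesis .
  qed
qed

lemma nc2_upper_block_second:
  assumes f: "f \<in> nc2 \<Omega>" and X: "X \<in> \<Omega> n" and Y: "Y \<in> \<Omega> m" and Y': "Y' \<in> \<Omega> m'" and u: "u \<in> idx n"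
    and \<gamma>: "\<gamma> \<in> carrier_mat m m'"
  defines "U \<equiv> upper_block Y (scalar_mat \<gamma>) Y'"
  shows "p < m \<Longrightarrow> q < m \<Longrightarrow> f n (m + m') X U u (p, q) = f n m X Y u (p, q)"
    and "p < m' \<Longrightarrow> q < m \<Longrightarrow> f n (m + m') X U u (m + p, q) = 0"
    and "p < m' \<Longrightarrow> q < m' \<Longrightarrow> f n (m + m') X U u (m + p, m + q) = f n m' X Y' u (p, q)"
    and "p < m \<Longrightarrow> q < m' \<Longrightarrow> f n (m + m') X U u (p, m + q) =
      (\<Sum>b<m. \<Sum>c<m'. \<gamma> $$ (b, c) * id_partial f n m m' X Y Y' u (p, b) (c, q))"
  using nc2_upper_block_first[OF swap2_nc2[OF f] Y Y' X u \<gamma>]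
  by (simp_all add: U_def swap2_def[of f] id_partial_swap2[of f] cong: sum.cong)

text \<open>The defining identity of \<^const>\<open>Delta10\<close>, with the bilinear map of \<open>(\<partial> \<otimes> id) f\<close> in the place of
  the unknown. It holds for all \<open>r\<close>, including \<open>0\<close>.\<close>

lemma lin_of_upper_block_first:
  assumes f: "f \<in> nc2 \<Omega>" and X: "X \<in> \<Omega> n" and X': "X' \<in> \<Omega> n'" and Y: "Y \<in> \<Omega> m"
    and \<gamma>: "\<gamma> \<in> carrier_mat n n'" and Z: "Z \<in> carrier_mat n m" and Z': "Z' \<in> carrier_mat n' m"
  shows "lin_of f (n + n') m (upper_block X (scalar_mat (r \<cdot>\<^sub>m \<gamma>)) X') Y (Z @\<^sub>r Z') =
    (lin_of f n m X Y Z + r \<cdot>\<^sub>m sharp3 n n' m (partial_id f n n' m X X' Y) \<gamma> Z')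
      @\<^sub>r lin_of f n' m X' Y Z'" (is "lin_of f _ _ ?U _ _ = (_ + _ \<cdot>\<^sub>m ?W) @\<^sub>r _")
proof (rule eq_matI)
  let ?P = "partial_id f n n' m X X' Y"
  let ?R = "(lin_of f n m X Y Z + r \<cdot>\<^sub>m ?W) @\<^sub>r lin_of f n' m X' Y Z'"
  have r\<gamma>: "r \<cdot>\<^sub>m \<gamma> \<in> carrier_mat n n'" using \<gamma> by simp
  note coeff = nc2_upper_block_first[OF f X X' Y _ r\<gamma>]
  fix i q assume "i < dim_row ?R" "q < dim_col ?R"
  hence iq: "i < n + n'" "q < m" by (auto simp: append_rows_def)
  have Z1: "(Z @\<^sub>r Z') $$ (j, p) = Z $$ (j, p)" if "j < n" "p < m" for j p
    using that Z Z' by (auto simp: append_rows_def)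
  have Z2: "(Z @\<^sub>r Z') $$ (n + l, p) = Z' $$ (l, p)" if "l < n'" "p < m" for l p
    using that Z Z' by (auto simp: append_rows_def)
  have split: "lin_of f (n + n') m ?U Y (Z @\<^sub>r Z') $$ (i, q) =
      (\<Sum>j<n. \<Sum>p<m. f (n + n') m ?U Y (i, j) (p, q) * Z $$ (j, p)) +
      (\<Sum>l<n'. \<Sum>p<m. f (n + n') m ?U Y (i, n + l) (p, q) * Z' $$ (l, p))"
    using iq by (simp add: lin_of_index sum_lessThan_add Z1 Z2)
  show "lin_of f (n + n') m ?U Y (Z @\<^sub>r Z') $$ (i, q) = ?R $$ (i, q)"
  proof (cases "i < n")
    case True
    have "(\<Sum>l<n'. \<Sum>p<m. f (n + n') m ?U Y (i, n + l) (p, q) * Z' $$ (l, p)) =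
        (\<Sum>l<n'. \<Sum>p<m. r * (\<Sum>j<n. \<Sum>k<n'. ?P (i, j) (k, l) (p, q) * \<gamma> $$ (j, k) * Z' $$ (l, p)))"
    proof (intro sum.cong refl)
      fix l p assume "l \<in> {..<n'}" "p \<in> {..<m}"
      hence "f (n + n') m ?U Y (i, n + l) (p, q) =
          (\<Sum>j<n. \<Sum>k<n'. (r \<cdot>\<^sub>m \<gamma>) $$ (j, k) * ?P (i, j) (k, l) (p, q))"
        using True iq by (intro coeff(4)) (auto simp: idx_def)
      also have "\<dots> = r * (\<Sum>j<n. \<Sum>k<n'. ?P (i, j) (k, l) (p, q) * \<gamma> $$ (j, k))"
        using \<gamma> by (simp add: sum_distrib_left mult_ac)
      finally show "f (n + n') m ?U Y (i, n + l) (p, q) * Z' $$ (l, p) =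
          r * (\<Sum>j<n. \<Sum>k<n'. ?P (i, j) (k, l) (p, q) * \<gamma> $$ (j, k) * Z' $$ (l, p))"
        by (simp add: sum_distrib_right mult.assoc)
    qed
    also have "\<dots> = r * (\<Sum>l<n'. \<Sum>p<m. \<Sum>j<n. \<Sum>k<n'. ?P (i, j) (k, l) (p, q) * \<gamma> $$ (j, k) * Z' $$ (l, p))"
      by (simp only: sum_distrib_left)
    also have "\<dots> = r * ?W $$ (i, q)"
      using True iq by (subst sum_swap_pairs[symmetric]) (simp add: sharp3_def)
    finally have second: "(\<Sum>l<n'. \<Sum>p<m. f (n + n') m ?U Y (i, n + l) (p, q) * Z' $$ (l, p)) = r * ?W $$ (i, q)" .
    have "(\<Sum>j<n. \<Sum>p<m. f (n + n') m ?U Y (i, j) (p, q) * Z $$ (j, p)) = lin_of f n m X Y Z $$ (i, q)"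
      using True iq by (simp add: lin_of_index coeff(1) idx_def)
    with second split True iq show ?thesis by (simp add: append_rows_def)
  next
    case False
    then obtain i' where i': "i = n + i'" "i' < n'" using iq by (metis add_diff_inverse_nat nat_add_left_cancel_less)
    have "(\<Sum>j<n. \<Sum>p<m. f (n + n') m ?U Y (i, j) (p, q) * Z $$ (j, p)) = 0"
      using i' iq by (simp add: coeff(2) idx_def)
    moreover have "(\<Sum>l<n'. \<Sum>p<m. f (n + n') m ?U Y (i, n + l) (p, q) * Z' $$ (l, p)) =
        lin_of f n' m X' Y Z' $$ (i', q)"
      using i' iq by (simp add: lin_of_index coeff(3) idx_def)
    ultimately show ?thesis using split i' iq by (simp add: append_rows_def)
  qed
qed (auto simp: append_rows_def)

text \<open>The defining identity of \<^const>\<open>Delta11\<close>, with the bilinear map of \<open>(id \<otimes> \<partial>) f\<close> in the place of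
  the unknown.\<close>

lemma lin_of_upper_block_second:
  assumes f: "f \<in> nc2 \<Omega>" and X: "X \<in> \<Omega> n" and Y: "Y \<in> \<Omega> m" and Y': "Y' \<in> \<Omega> m'"
    and \<gamma>: "\<gamma> \<in> carrier_mat m m'" and Z: "Z \<in> carrier_mat n m" and Z': "Z' \<in> carrier_mat n m'"
  shows "lin_of f n (m + m') X (upper_block Y (scalar_mat (r \<cdot>\<^sub>m \<gamma>)) Y') (Z @\<^sub>h Z') =
    lin_of f n m X Y Z @\<^sub>h
      (r \<cdot>\<^sub>m sharp3 n m m' (id_partial f n m m' X Y Y') Z \<gamma> + lin_of f n m' X Y' Z')"
    (is "lin_of f _ _ _ ?U _ = _ @\<^sub>h (_ \<cdot>\<^sub>m ?W + _)")
proof (rule eq_matI)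
  let ?P = "id_partial f n m m' X Y Y'"
  let ?R = "lin_of f n m X Y Z @\<^sub>h (r \<cdot>\<^sub>m ?W + lin_of f n m' X Y' Z')"
  have r\<gamma>: "r \<cdot>\<^sub>m \<gamma> \<in> carrier_mat m m'" using \<gamma> by simp
  note coeff = nc2_upper_block_second[OF f X Y Y' _ r\<gamma>]
  fix i q assume "i < dim_row ?R" "q < dim_col ?R"
  hence iq: "i < n" "q < m + m'" by (auto simp: append_cols_mat_def)
  have Z1: "(Z @\<^sub>h Z') $$ (j, p) = Z $$ (j, p)" if "j < n" "p < m" for j p
    using that Z Z' by (auto simp: append_cols_mat_def)
  have Z2: "(Z @\<^sub>h Z') $$ (j, m + p) = Z' $$ (j, p)" if "j < n" "p < m'" for j p
    using that Z Z' by (auto simp: append_cols_mat_def)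
  have split: "lin_of f n (m + m') X ?U (Z @\<^sub>h Z') $$ (i, q) =
      (\<Sum>j<n. (\<Sum>p<m. f n (m + m') X ?U (i, j) (p, q) * Z $$ (j, p)) +
        (\<Sum>p<m'. f n (m + m') X ?U (i, j) (m + p, q) * Z' $$ (j, p)))"
    using iq by (simp add: lin_of_index sum_lessThan_add Z1 Z2)
  show "lin_of f n (m + m') X ?U (Z @\<^sub>h Z') $$ (i, q) = ?R $$ (i, q)"
  proof (cases "q < m")
    case True
    thus ?thesis using split iq
      by (simp add: append_cols_mat_def lin_of_index coeff(1,2) idx_def)
  next
    case False
    then obtain q' where q': "q = m + q'" "q' < m'" using iq by (metis add_diff_inverse_nat nat_add_left_cancel_less)
    have "(\<Sum>j<n. \<Sum>k<m. f n (m + m') X ?U (i, j) (k, q) * Z $$ (j, k)) =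
        (\<Sum>j<n. \<Sum>k<m. r * (\<Sum>l<m. \<Sum>p<m'. ?P (i, j) (k, l) (p, q') * Z $$ (j, k) * \<gamma> $$ (l, p)))"
    proof (intro sum.cong refl)
      fix j k assume "j \<in> {..<n}" "k \<in> {..<m}"
      hence "f n (m + m') X ?U (i, j) (k, q) =
          (\<Sum>l<m. \<Sum>p<m'. (r \<cdot>\<^sub>m \<gamma>) $$ (l, p) * ?P (i, j) (k, l) (p, q'))"
        unfolding q'(1) using q' iq by (intro coeff(4)) (auto simp: idx_def)
      also have "\<dots> = r * (\<Sum>l<m. \<Sum>p<m'. ?P (i, j) (k, l) (p, q') * \<gamma> $$ (l, p))"
        using \<gamma> by (simp add: sum_distrib_left mult_ac)
      finally show "f n (m + m') X ?U (i, j) (k, q) * Z $$ (j, k) =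
          r * (\<Sum>l<m. \<Sum>p<m'. ?P (i, j) (k, l) (p, q') * Z $$ (j, k) * \<gamma> $$ (l, p))"
        by (simp add: sum_distrib_right sum_distrib_left mult_ac)
    qed
    also have "\<dots> = r * ?W $$ (i, q')"
      using q' iq by (simp add: sharp3_def sum_distrib_left)
    finally have first: "(\<Sum>j<n. \<Sum>k<m. f n (m + m') X ?U (i, j) (k, q) * Z $$ (j, k)) = r * ?W $$ (i, q')" .
    have "(\<Sum>j<n. \<Sum>p<m'. f n (m + m') X ?U (i, j) (m + p, q) * Z' $$ (j, p)) =
        lin_of f n m' X Y' Z' $$ (i, q')"
      using q' iq by (simp add: lin_of_index coeff(3) idx_def)
    with first split q' iq show ?thesis
      by (simp add: append_cols_mat_def sum.distrib)
  qed
qed (auto simp: append_cols_mat_def)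

lemma Delta10_eq_sharp3:
  assumes f: "f \<in> nc2 \<Omega>" and X: "X \<in> \<Omega> n" and X': "X' \<in> \<Omega> n'" and Y: "Y \<in> \<Omega> m"
    and \<gamma>: "\<gamma> \<in> carrier_mat n n'" and Z': "Z' \<in> carrier_mat n' m"
  shows "Delta10 \<Omega> (lin_of f) n n' m X X' Y \<gamma> Z' = sharp3 n n' m (partial_id f n n' m X X' Y) \<gamma> Z'"
    (is "_ = ?W")
  unfolding Delta10_def
proof (rule the_equality, intro conjI allI ballI impI)
  fix r and Z :: "complex mat" assume "Z \<in> carrier_mat n m"
  thus "lin_of f (n + n') m (upper_block X (scalar_mat (r \<cdot>\<^sub>m \<gamma>)) X') Y (Z @\<^sub>r Z') =
      (lin_of f n m X Y Z + r \<cdot>\<^sub>m ?W) @\<^sub>r lin_of f n' m X' Y Z'"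
    by (rule lin_of_upper_block_first[OF f X X' Y \<gamma> _ Z'])
next
  let ?Z = "0\<^sub>m n m :: complex mat"
  let ?U = "upper_block X (scalar_mat (1 \<cdot>\<^sub>m \<gamma>)) X'"
  fix V assume V: "V \<in> carrier_mat n m \<and> (\<forall>r. \<forall>Z\<in>carrier_mat n m.
      r \<noteq> 0 \<and> upper_block X (scalar_mat (r \<cdot>\<^sub>m \<gamma>)) X' \<in> \<Omega> (n + n') \<longrightarrow>
      lin_of f (n + n') m (upper_block X (scalar_mat (r \<cdot>\<^sub>m \<gamma>)) X') Y (Z @\<^sub>r Z') =
        (lin_of f n m X Y Z + r \<cdot>\<^sub>m V) @\<^sub>r lin_of f n' m X' Y Z')"
  hence Vc: "V \<in> carrier_mat n m" by (rule conjunct1)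
  \<comment> \<open>The identity for the single value \<open>r = 1\<close>, which is admissible, already determines \<open>V\<close>.\<close>
  have "?U \<in> \<Omega> (n + n')" using \<gamma> by (intro upper_block_mem[OF X X']) simp
  hence "lin_of f (n + n') m ?U Y (?Z @\<^sub>r Z') = (lin_of f n m X Y ?Z + 1 \<cdot>\<^sub>m V) @\<^sub>r lin_of f n' m X' Y Z'"
    using V zero_carrier_mat zero_neq_one by metis
  moreover have "lin_of f (n + n') m ?U Y (?Z @\<^sub>r Z') =
      (lin_of f n m X Y ?Z + 1 \<cdot>\<^sub>m ?W) @\<^sub>r lin_of f n' m X' Y Z'"
    by (rule lin_of_upper_block_first[OF f X X' Y \<gamma> _ Z']) simp
  ultimately have "lin_of f n m X Y ?Z + 1 \<cdot>\<^sub>m V = lin_of f n m X Y ?Z + 1 \<cdot>\<^sub>m ?W"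
    using Vc append_rows_eq_iff[of "lin_of f n m X Y ?Z + 1 \<cdot>\<^sub>m V" n m "lin_of f n' m X' Y Z'" n'
        "lin_of f n m X Y ?Z + 1 \<cdot>\<^sub>m ?W" "lin_of f n' m X' Y Z'"]
    by simp
  thus "V = ?W" by (rule add_mat_left_cancel[OF lin_of_carrier Vc sharp3_carrier])
qed simp

lemma Delta11_eq_sharp3:
  assumes f: "f \<in> nc2 \<Omega>" and X: "X \<in> \<Omega> n" and Y: "Y \<in> \<Omega> m" and Y': "Y' \<in> \<Omega> m'"
    and \<gamma>: "\<gamma> \<in> carrier_mat m m'" and Z: "Z \<in> carrier_mat n m"
  shows "Delta11 \<Omega> (lin_of f) n m m' X Y Y' Z \<gamma> = sharp3 n m m' (id_partial f n m m' X Y Y') Z \<gamma>"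
    (is "_ = ?W")
  unfolding Delta11_def
proof (rule the_equality, intro conjI allI ballI impI)
  fix r and Z' :: "complex mat" assume "Z' \<in> carrier_mat n m'"
  thus "lin_of f n (m + m') X (upper_block Y (scalar_mat (r \<cdot>\<^sub>m \<gamma>)) Y') (Z @\<^sub>h Z') =
      lin_of f n m X Y Z @\<^sub>h (r \<cdot>\<^sub>m ?W + lin_of f n m' X Y' Z')"
    by (rule lin_of_upper_block_second[OF f X Y Y' \<gamma> Z])
next
  let ?Z = "0\<^sub>m n m' :: complex mat"
  let ?U = "upper_block Y (scalar_mat (1 \<cdot>\<^sub>m \<gamma>)) Y'"
  fix V assume V: "V \<in> carrier_mat n m' \<and> (\<forall>r. \<forall>Z'\<in>carrier_mat n m'.
      r \<noteq> 0 \<and> upper_block Y (scalar_mat (r \<cdot>\<^sub>m \<gamma>)) Y' \<in> \<Omega> (m + m') \<longrightarrow>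
      lin_of f n (m + m') X (upper_block Y (scalar_mat (r \<cdot>\<^sub>m \<gamma>)) Y') (Z @\<^sub>h Z') =
        lin_of f n m X Y Z @\<^sub>h (r \<cdot>\<^sub>m V + lin_of f n m' X Y' Z'))"
  hence Vc: "V \<in> carrier_mat n m'" by (rule conjunct1)
  have "?U \<in> \<Omega> (m + m')" using \<gamma> by (intro upper_block_mem[OF Y Y']) simp
  hence "lin_of f n (m + m') X ?U (Z @\<^sub>h ?Z) = lin_of f n m X Y Z @\<^sub>h (1 \<cdot>\<^sub>m V + lin_of f n m' X Y' ?Z)"
    using V zero_carrier_mat zero_neq_one by metis
  moreover have "lin_of f n (m + m') X ?U (Z @\<^sub>h ?Z) =
      lin_of f n m X Y Z @\<^sub>h (1 \<cdot>\<^sub>m ?W + lin_of f n m' X Y' ?Z)"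
    by (rule lin_of_upper_block_second[OF f X Y Y' \<gamma> Z]) simp
  ultimately have "lin_of f n m' X Y' ?Z + 1 \<cdot>\<^sub>m V = lin_of f n m' X Y' ?Z + 1 \<cdot>\<^sub>m ?W"
    using Vc append_cols_eq_iff[of "lin_of f n m X Y Z" n m "1 \<cdot>\<^sub>m V + lin_of f n m' X Y' ?Z" m'
        "lin_of f n m X Y Z" "1 \<cdot>\<^sub>m ?W + lin_of f n m' X Y' ?Z"]
    by (simp add: comm_add_mat[of "lin_of f n m' X Y' ?Z" n m'])
  thus "V = ?W" by (rule add_mat_left_cancel[OF lin_of_carrier Vc sharp3_carrier])
qed simp

lemma id_partial_tens3: "id_partial f l n n' Y X X' \<in> tens3 l n n'"
  by (auto simp: tens3_def id_partial_def split: if_splits)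

lemma partial21_eq_partial_id:
  assumes "f \<in> nc2 \<Omega>" "X1 \<in> \<Omega> n1" "X2 \<in> \<Omega> n2" "X3 \<in> \<Omega> n3"
  shows "partial21 \<Omega> f n1 n2 n3 X1 X2 X3 = partial_id f n1 n2 n3 X1 X2 X3"
  unfolding partial21_def
  by (rule tensor_of_bilinear_eqI[OF partial_id_tens3 Delta10_eq_sharp3[OF assms]])

lemma partial22_eq_id_partial:
  assumes "f \<in> nc2 \<Omega>" "X1 \<in> \<Omega> n1" "X2 \<in> \<Omega> n2" "X3 \<in> \<Omega> n3"
  shows "partial22 \<Omega> f n1 n2 n3 X1 X2 X3 = id_partial f n1 n2 n3 X1 X2 X3"
  unfolding partial22_def
  by (rule tensor_of_bilinear_eqI[OF id_partial_tens3]) (rule Delta11_eq_sharp3[OF assms])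

lemma nc3_cong:
  assumes g: "g \<in> nc3 \<Omega>"
    and eq: "\<And>n1 n2 n3 X1 X2 X3. X1 \<in> \<Omega> n1 \<Longrightarrow> X2 \<in> \<Omega> n2 \<Longrightarrow> X3 \<in> \<Omega> n3 \<Longrightarrow>
      h n1 n2 n3 X1 X2 X3 = g n1 n2 n3 X1 X2 X3"
  shows "h \<in> nc3 \<Omega>"
  unfolding nc3_def
proof (intro CollectI conjI allI ballI)
  show "h n1 n2 n3 X1 X2 X3 \<in> tens3 n1 n2 n3"
    if "X1 \<in> \<Omega> n1" "X2 \<in> \<Omega> n2" "X3 \<in> \<Omega> n3" for n1 n2 n3 X1 X2 X3
    using that g by (simp add: nc3_def eq)
next
  fix n2 n3 X2 X3 v w
  assume *: "X2 \<in> \<Omega> n2" "X3 \<in> \<Omega> n3" "v \<in> idx n2" "w \<in> idx n3"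
  hence "nc_fun \<Omega> (\<lambda>n1 X1. mat n1 n1 (\<lambda>u. g n1 n2 n3 X1 X2 X3 u v w))"
    using g by (simp add: nc3_def)
  thus "nc_fun \<Omega> (\<lambda>n1 X1. mat n1 n1 (\<lambda>u. h n1 n2 n3 X1 X2 X3 u v w))"
    by (rule nc_fun_cong) (simp add: eq *)
next
  fix n1 n3 X1 X3 u w
  assume *: "X1 \<in> \<Omega> n1" "X3 \<in> \<Omega> n3" "u \<in> idx n1" "w \<in> idx n3"
  hence "nc_fun \<Omega> (\<lambda>n2 X2. mat n2 n2 (\<lambda>v. g n1 n2 n3 X1 X2 X3 u v w))"
    using g by (simp add: nc3_def)
  thus "nc_fun \<Omega> (\<lambda>n2 X2. mat n2 n2 (\<lambda>v. h n1 n2 n3 X1 X2 X3 u v w))"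
    by (rule nc_fun_cong) (simp add: eq *)
next
  fix n1 n2 X1 X2 u v
  assume *: "X1 \<in> \<Omega> n1" "X2 \<in> \<Omega> n2" "u \<in> idx n1" "v \<in> idx n2"
  hence "nc_fun \<Omega> (\<lambda>n3 X3. mat n3 n3 (\<lambda>w. g n1 n2 n3 X1 X2 X3 u v w))"
    using g by (simp add: nc3_def)
  thus "nc_fun \<Omega> (\<lambda>n3 X3. mat n3 n3 (\<lambda>w. h n1 n2 n3 X1 X2 X3 u v w))"
    by (rule nc_fun_cong) (simp add: eq *)
qed

end

section \<open>Admissibility of open fully matricial sets\<close>

text \<open>A small multiple of the direction \<open>\<gamma>\<close> is admissible since \<open>X \<oplus> Y\<close> is an interior point of the
  domain; a diagonal similarity then rescales the corner to \<open>\<gamma>\<close> itself.\<close>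

lemma open_fully_matricial_nc_domain:
  fixes G :: "'a::unital_cstar_algebra set"
  assumes G: "operator_system G" and N: "matrix_cstar_norms N" and \<Omega>: "open_fully_matricial N G \<Omega>"
  shows "nc_domain \<Omega>"
proof
  have pos: "n \<ge> 1" if "X \<in> \<Omega> n" for X n
    using that \<Omega> unfolding open_fully_matricial_def by (cases n) auto
  have mats: "X \<in> mats n n G" if "X \<in> \<Omega> n" for X n
    using that \<Omega> pos[OF that] unfolding open_fully_matricial_def by blast
  show square: "X \<in> carrier_mat n n" if "X \<in> \<Omega> n" for X n
    using mats[OF that] by (simp add: mats_def)
  show similar: "scalar_mat s * X * scalar_mat t \<in> \<Omega> n" if "X \<in> \<Omega> n" "(s, t) \<in> GL n" for X n s t
  proof -
    have "(\<lambda>X. scalar_mat s * X * scalar_mat t) ` \<Omega> n = \<Omega> n"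
      using \<Omega> pos[OF that(1)] that(2) unfolding open_fully_matricial_def by fastforce
    thus ?thesis using that(1) by blast
  qed
  fix X Y n m and \<gamma> :: "complex mat"
  assume X: "X \<in> \<Omega> n" and Y: "Y \<in> \<Omega> m" and \<gamma>: "\<gamma> \<in> carrier_mat n m"
  note [simp] = X[THEN square] Y[THEN square] \<gamma>
  note [simp] = this[THEN carrier_matD(1)] this[THEN carrier_matD(2)]
  define D where "D = dsum X Y"
  have "{dsum X Y | X Y. X \<in> \<Omega> n \<and> Y \<in> \<Omega> m} =
      \<Omega> (n + m) \<inter> {dsum X Y | X Y. X \<in> mats n n G \<and> Y \<in> mats m m G}"
    using \<Omega> pos[OF X] pos[OF Y] unfolding open_fully_matricial_def by blast
  hence D: "D \<in> \<Omega> (n + m)" using X Y unfolding D_def by blast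
  have "n + m \<ge> 1" using pos[OF X] by simp
  then obtain d where d: "d > 0"
    and ball: "\<And>V. V \<in> mats (n + m) (n + m) G \<Longrightarrow> N (n + m) (V - D) < d \<Longrightarrow> V \<in> \<Omega> (n + m)"
    using \<Omega> D unfolding open_fully_matricial_def by metis
  have norm: "cstar_norm_mat (n + m) (N (n + m))"
    using N \<open>n + m \<ge> 1\<close> by (simp add: matrix_cstar_norms_def)
  define H where "H = four_block_mat (0\<^sub>m n n) (scalar_mat \<gamma>) (0\<^sub>m m n) (0\<^sub>m m m :: 'a mat)"
  have H: "H \<in> carrier_mat (n + m) (n + m)" by (auto simp: H_def)
  have NH: "N (n + m) H \<ge> 0" using norm H by (simp add: cstar_norm_mat_def)
  \<comment> \<open>Adding \<open>1\<close> keeps the denominator positive when \<open>H = 0\<close>.\<close>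
  define c where "c = d / (N (n + m) H + 1)"
  have c: "c > 0" using d NH by (simp add: c_def)
  have "c * N (n + m) H < d" using d NH by (simp add: c_def field_simps)
  hence small: "N (n + m) (cscale_mat (complex_of_real c) H) < d"
    using norm H c by (simp add: cstar_norm_mat_def)
  define V where "V = upper_block X (scalar_mat (complex_of_real c \<cdot>\<^sub>m \<gamma>)) Y"
  have Vb: "V = four_block_mat X (scalar_mat (complex_of_real c \<cdot>\<^sub>m \<gamma>)) (0\<^sub>m m n) Y"
    unfolding V_def by (rule upper_block_four_block) auto
  have Db: "D = four_block_mat X (0\<^sub>m n m) (0\<^sub>m m n) Y"
    unfolding D_def by (rule dsum_four_block(1)) auto
  have "V - D = cscale_mat (complex_of_real c) H"
    unfolding Vb Db H_def
    by (rule eq_matI) (auto simp: cscale_mat_def scalar_mat_def scaleC_scaleC scaleC_zero_right)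
  hence near: "N (n + m) (V - D) < d" using small by simp
  have G0: "0 \<in> G" and G1: "\<And>z. z *\<^sub>C 1 \<in> G"
    using G scaleC_zero_left[of "1::'a"] unfolding operator_system_def by metis+
  have "elements_mat V \<subseteq> elements_mat X \<union> elements_mat (scalar_mat (complex_of_real c \<cdot>\<^sub>m \<gamma>)) \<union>
      elements_mat (0\<^sub>m m n) \<union> elements_mat Y"
    unfolding Vb by (rule elements_four_block_mat[of _ n n _ m _ m]) auto
  moreover have "elements_mat (scalar_mat (complex_of_real c \<cdot>\<^sub>m \<gamma>)) \<subseteq> G"
    using G1 by (auto simp: scalar_mat_def)
  moreover have "elements_mat X \<subseteq> G" "elements_mat Y \<subseteq> G"
    using mats[OF X] mats[OF Y] by (simp_all add: mats_def)
  moreover have "elements_mat (0\<^sub>m m n :: 'a mat) \<subseteq> G" using elements_0_mat G0 by blast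
  ultimately have "elements_mat V \<subseteq> G" by blast
  hence "V \<in> mats (n + m) (n + m) G" by (auto simp: mats_def Vb)
  hence V: "V \<in> \<Omega> (n + m)" using ball near by blast
  define a where "a = inverse (complex_of_real c) \<cdot>\<^sub>m (1\<^sub>m n :: complex mat)"
  define b where "b = complex_of_real c \<cdot>\<^sub>m (1\<^sub>m n :: complex mat)"
  have ab [simp]: "a \<in> carrier_mat n n" "b \<in> carrier_mat n n" by (simp_all add: a_def b_def)
  note [simp] = ab[THEN carrier_matD(1)] ab[THEN carrier_matD(2)]
  have ab1: "a * b = 1\<^sub>m n" "b * a = 1\<^sub>m n"
    using c by (auto intro!: eq_matI simp: a_def b_def mult_smult_distrib[of _ n n _ n])
  define s where "s = four_block_mat a (0\<^sub>m n m) (0\<^sub>m m n) (1\<^sub>m m)"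
  define t where "t = four_block_mat b (0\<^sub>m n m) (0\<^sub>m m n) (1\<^sub>m m)"
  have "s * t = 1\<^sub>m (n + m)" "t * s = 1\<^sub>m (n + m)"
    unfolding s_def t_def
    by (subst upper_triangular_mult[of _ n n _ m _ m _ n _ m]; simp add: ab1)+
  hence "(s, t) \<in> GL (n + m)" by (simp add: GL_def s_def t_def)
  hence "scalar_mat s * V * scalar_mat t \<in> \<Omega> (n + m)" by (rule similar[OF V])
  also have "scalar_mat s * V * scalar_mat t = upper_block X (scalar_mat \<gamma>) Y"
  proof -
    have ss: "scalar_mat s = four_block_mat (scalar_mat a) (0\<^sub>m n m) (0\<^sub>m m n) (1\<^sub>m m)"
      unfolding s_def by (subst scalar_mat_four_block[of _ n n _ m _ m]) auto
    have st: "scalar_mat t = four_block_mat (scalar_mat b) (0\<^sub>m n m) (0\<^sub>m m n) (1\<^sub>m m)"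
      unfolding t_def by (subst scalar_mat_four_block[of _ n n _ m _ m]) auto
    have corner_eq: "scalar_mat a * scalar_mat (complex_of_real c \<cdot>\<^sub>m \<gamma>) = scalar_mat \<gamma>"
    proof -
      have "a * (complex_of_real c \<cdot>\<^sub>m \<gamma>) = \<gamma>"
        using c unfolding a_def
        by (subst mult_smult_assoc_mat[of _ n n _ m])
          (auto intro!: eq_matI)
      thus ?thesis by (simp add: scalar_mat_mult[symmetric, of a n n _ m])
    qed
    have "scalar_mat s * V = four_block_mat (scalar_mat a * X) (scalar_mat \<gamma>) (0\<^sub>m m n) Y"
      unfolding ss Vb by (subst upper_triangular_mult[of _ n n _ m _ m _ n _ m]) (auto simp: corner_eq)
    hence "scalar_mat s * V * scalar_mat t =
        four_block_mat (scalar_mat a * X * scalar_mat b) (scalar_mat \<gamma>) (0\<^sub>m m n) Y"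
      unfolding st
      by (simp, subst upper_triangular_mult[of _ n n _ m _ m _ n _ m]) (auto intro!: mult_carrier_mat[of _ n n _ n])
    also have "scalar_mat a * X = X * scalar_mat a"
      unfolding a_def by (rule scalar_mat_smult_one_commute[symmetric]) simp
    also have "X * scalar_mat a * scalar_mat b = X * (scalar_mat a * scalar_mat b)"
      by (rule assoc_mult_mat[of _ n n _ n _ n]) auto
    also have "scalar_mat a * scalar_mat b = (1\<^sub>m n :: 'a mat)"
      using scalar_mat_mult[OF ab, symmetric] ab1 by simp
    finally show ?thesis by (simp add: upper_block_four_block[of _ n _ m])
  qed
  finally show "upper_block X (scalar_mat \<gamma>) Y \<in> \<Omega> (n + m)" .
qed

theorem proposition10p20:
  fixes G :: "'a::unital_cstar_algebra set"
    and N :: "nat \<Rightarrow> 'a mat \<Rightarrow> real"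
    and \<Omega> :: "nat \<Rightarrow> 'a mat set"
  assumes "operator_system G"
    and "matrix_cstar_norms N"
    and "open_fully_matricial N G \<Omega>"
  shows "(\<forall>f\<in>nc2 \<Omega>. partial21 \<Omega> f \<in> nc3 \<Omega> \<and> partial22 \<Omega> f \<in> nc3 \<Omega>) \<and>
    (\<forall>f\<in>analytic2 N G \<Omega>. \<forall>n1 n2 n3. \<forall>X1\<in>\<Omega> n1. \<forall>X2\<in>\<Omega> n2. \<forall>X3\<in>\<Omega> n3.
       partial21 \<Omega> f n1 n2 n3 X1 X2 X3 = partial_id f n1 n2 n3 X1 X2 X3 \<and>
       partial22 \<Omega> f n1 n2 n3 X1 X2 X3 = id_partial f n1 n2 n3 X1 X2 X3)"
proof -
  interpret nc_domain \<Omega> by (rule open_fully_matricial_nc_domain[OF assms])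
  have "partial21 \<Omega> f \<in> nc3 \<Omega>" "partial22 \<Omega> f \<in> nc3 \<Omega>" if "f \<in> nc2 \<Omega>" for f
    using nc3_cong[OF partial_id_nc3[OF that] partial21_eq_partial_id[OF that]]
      nc3_cong[OF id_partial_nc3[OF that] partial22_eq_id_partial[OF that]] by auto
  moreover have "f \<in> nc2 \<Omega>" if "f \<in> analytic2 N G \<Omega>" for f
    using that by (simp add: analytic2_def)
  ultimately show ?thesis
    using partial21_eq_partial_id partial22_eq_id_partial by auto
qed

end
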